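(* Let $N\ge1$, let $V$ be the vertex set of the infinite $N$-ary tree and $\Delta$ its graph Laplacian on $l^2(V)$. Let $\mu_c$ be the semicircle measure $d\mu_c=\frac{2}{\pi}\sqrt{1-x^2}\,dx$ on $[-1,1]$, and define on $L^2(\mu_c)$ the operators $(M_xf)(x)=xf(x)$, $E(f)=\int_{-1}^1f\,d\mu_c$ (regarded as a constant function), and $A_\Delta f=2\sqrt N M_xf+E(f)$. If $N\ge2$, then $\Delta$ is unitarily equivalent to $$\big((N+1)I-A_\Delta\big)\oplus\bigoplus_{n\in\mathbb{N}}\big((N+1)I-2\sqrt N M_x\big)\quad\text{on}\quad\bigoplus_{n\ge0}L^2(\mu_c).$$ If $N=1$, then $\Delta$ is unitarily equivalent to $(N+1)I-A_\Delta$ on $L^2(\mu_c)$.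
   Context: $V$ is the set of finite words over $\{1,\dots,N\}$ including the empty word $\emptyset$; the $N$-ary tree has edges exactly the pairs $\{\omega,\omega i\}$, $\omega\in V$, $i\in\{1,\dots,N\}$, where $\omega i$ is $\omega$ with the letter $i$ appended. $\Delta$ is the graph Laplacian with conductance $1$: $(\Delta v)(x)=\sum_{y\sim x}(v(x)-v(y))$, a bounded selfadjoint operator on $l^2(V)$. *)

theory Defs
  imports "HOL-Analysis.Analysis" "HOL-Probability.Probability"
begin

text \<open>Vertices: finite words over the alphabet 1..N, as lists; appending a letter
  is appending at the end of the list.\<close>
definition tree_V :: "nat \<Rightarrow> nat list set" where
  "tree_V N = {w. set w \<subseteq> {1..N}}"

definition tree_lap :: "nat \<Rightarrow> (nat list \<Rightarrow> complex) \<Rightarrow> nat list \<Rightarrow> complex" where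
  "tree_lap N v x =
     (if x \<in> tree_V N then
        (\<Sum>i\<in>{1..N}. v x - v (x @ [i])) + (if x = [] then 0 else v x - v (butlast x))
      else 0)"

definition l2V :: "nat \<Rightarrow> (nat list \<Rightarrow> complex) set" where
  "l2V N = {f. (\<forall>w. w \<notin> tree_V N \<longrightarrow> f w = 0) \<and>
               (\<lambda>w. (cmod (f w))\<^sup>2) summable_on tree_V N}"

definition l2V_norm :: "nat \<Rightarrow> (nat list \<Rightarrow> complex) \<Rightarrow> real" where
  "l2V_norm N f = sqrt (\<Sum>\<^sub>\<infinity>w\<in>tree_V N. (cmod (f w))\<^sup>2)"

definition mu_c :: "real measure" where
  "mu_c = density lborel
      (\<lambda>x. ennreal (indicator {-1..1} x * (2 / pi) * sqrt (1 - x\<^sup>2)))"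

text \<open>Square-integrable (representatives of) elements of L^2(mu_c).\<close>
definition L2c :: "(real \<Rightarrow> complex) set" where
  "L2c = {f. f \<in> borel_measurable mu_c \<and> integrable mu_c (\<lambda>x. (cmod (f x))\<^sup>2)}"

definition dsum :: "nat set \<Rightarrow> (nat \<Rightarrow> real \<Rightarrow> complex) set" where
  "dsum I = {g. (\<forall>n. n \<notin> I \<longrightarrow> g n = (\<lambda>_. 0)) \<and> (\<forall>n\<in>I. g n \<in> L2c) \<and>
               (\<lambda>n. LINT x|mu_c. (cmod (g n x))\<^sup>2) summable_on I}"

definition dsum_norm :: "nat set \<Rightarrow> (nat \<Rightarrow> real \<Rightarrow> complex) \<Rightarrow> real" where
  "dsum_norm I g = sqrt (\<Sum>\<^sub>\<infinity>n\<in>I. LINT x|mu_c. (cmod (g n x))\<^sup>2)"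

definition dsum_eq :: "nat set \<Rightarrow> (nat \<Rightarrow> real \<Rightarrow> complex) \<Rightarrow> (nat \<Rightarrow> real \<Rightarrow> complex) \<Rightarrow> bool" where
  "dsum_eq I g h \<longleftrightarrow> (\<forall>n\<in>I. AE x in mu_c. g n x = h n x)"

definition Mx :: "(real \<Rightarrow> complex) \<Rightarrow> real \<Rightarrow> complex" where
  "Mx f = (\<lambda>x. complex_of_real x * f x)"

definition Ec :: "(real \<Rightarrow> complex) \<Rightarrow> complex" where
  "Ec f = (LINT x|mu_c. f x)"

definition A_Delta :: "nat \<Rightarrow> (real \<Rightarrow> complex) \<Rightarrow> real \<Rightarrow> complex" where
  "A_Delta N f = (\<lambda>x. complex_of_real (2 * sqrt (real N)) * Mx f x + Ec f)"

definition T_model :: "nat \<Rightarrow> (nat \<Rightarrow> real \<Rightarrow> complex) \<Rightarrow> nat \<Rightarrow> real \<Rightarrow> complex" where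
  "T_model N g = (\<lambda>n x.
     if n = 0 then of_nat (N + 1) * g 0 x - A_Delta N (g 0) x
     else of_nat (N + 1) * g n x - complex_of_real (2 * sqrt (real N)) * Mx (g n) x)"

definition unit_equiv ::
  "nat \<Rightarrow> ((nat list \<Rightarrow> complex) \<Rightarrow> nat list \<Rightarrow> complex) \<Rightarrow> nat set \<Rightarrow>
   ((nat \<Rightarrow> real \<Rightarrow> complex) \<Rightarrow> nat \<Rightarrow> real \<Rightarrow> complex) \<Rightarrow> bool" where
  "unit_equiv N L I T \<longleftrightarrow>
    (\<exists>U :: (nat list \<Rightarrow> complex) \<Rightarrow> nat \<Rightarrow> real \<Rightarrow> complex.
       (\<forall>f\<in>l2V N. U f \<in> dsum I) \<and>
       (\<forall>f\<in>l2V N. \<forall>g\<in>l2V N. \<forall>a b :: complex.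
           dsum_eq I (U (\<lambda>w. a * f w + b * g w)) (\<lambda>n x. a * U f n x + b * U g n x)) \<and>
       (\<forall>f\<in>l2V N. dsum_norm I (U f) = l2V_norm N f) \<and>
       (\<forall>h\<in>dsum I. \<exists>f\<in>l2V N. dsum_eq I (U f) h) \<and>
       (\<forall>f\<in>l2V N. dsum_eq I (U (L f)) (T (U f))))"

end

theory Submission
  imports Defs
begin

text \<open>
  Let \<open>S\<close> be the operator on \<open>l\<^sup>2(V)\<close> sending the indicator of a word to the sum of the
  indicators of its children.  Then \<open>\<Delta> = (N + 1) I - (S + S*) - P\<close>, where \<open>P\<close> is the
  projection onto the root.  Since \<open>S* S = N I\<close>, the operator \<open>S / \<surd>N\<close> is a pure isometry, and by
  its Wold decomposition \<open>l\<^sup>2(V)\<close> is a sum of copies of \<open>l\<^sup>2(\<nat>)\<close>, indexed by an orthonormal basis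
  of \<open>ker S*\<close>, on each of which \<open>S / \<surd>N\<close> is the unilateral shift.  Such a basis consists of the
  root vector and, for each word and each nontrivial character of the cyclic group of order \<open>N\<close>, that
  character on the children of the word.  The Chebyshev polynomials of the second kind
  form an orthonormal basis of \<open>L\<^sup>2(\<mu>\<^sub>c)\<close> in which the shift plus its adjoint is multiplication by
  \<open>2 x\<close>; the projection onto the root becomes the expectation on the zeroth summand.
\<close>

section \<open>Chebyshev polynomials and the semicircle measure\<close>

fun chebU :: "nat \<Rightarrow> real \<Rightarrow> real" where
  "chebU 0 x = 1"
| "chebU (Suc 0) x = 2 * x"
| "chebU (Suc (Suc n)) x = 2 * x * chebU (Suc n) x - chebU n x"

text \<open>With \<open>x = cos t\<close> the recursion of \<open>chebU\<close> becomes the addition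
  formula for \<open>sin\<close>; this trigonometric form makes the integrals against the semicircle
  computable.\<close>

lemma chebU_sin: "chebU n (cos t) * sin t = sin (real (Suc n) * t)"
proof (induction n "cos t" rule: chebU.induct)
  case 2
  show ?case using sin_double[of t] by simp
next
  case (3 n)
  have "sin (real (Suc (Suc (Suc n))) * t) + sin (real (Suc n) * t)
      = 2 * cos t * sin (real (Suc (Suc n)) * t)"
  proof -
    have "real (Suc (Suc (Suc n))) * t = real (Suc (Suc n)) * t + t"
      "real (Suc n) * t = real (Suc (Suc n)) * t - t"
      by (simp_all add: algebra_simps)
    then show ?thesis by (simp only: sin_diff sin_add) simp
  qed
  with 3 show ?case by (simp add: algebra_simps)
qed simp

lemma continuous_chebU [continuous_intros]: "continuous_on S (chebU n)"
  by (induction n "undefined :: real" rule: chebU.induct)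
     (simp_all add: chebU.simps[abs_def] continuous_intros)

lemma chebU_measurable [measurable]: "chebU n \<in> borel_measurable borel"
  by (intro borel_measurable_continuous_onI continuous_chebU)

text \<open>In the basis \<open>chebU\<close>, multiplication by \<open>2 x\<close> is the
  unilateral shift plus its adjoint; the case \<open>n = 0\<close> reflects the convention that the
  polynomial of index -1 vanishes.\<close>

lemma mult_x_chebU:
  "x * chebU n x = (chebU (Suc n) x + (if n = 0 then 0 else chebU (n - 1) x)) / 2"
  by (cases n) auto

section \<open>The semicircle law as a probability measure\<close>

definition semicircle_density :: "real \<Rightarrow> real" where
  "semicircle_density x = indicator {-1..1} x * (2 / pi) * sqrt (1 - x\<^sup>2)"

lemma semicircle_density_nonneg: "semicircle_density x \<ge> 0"
  by (auto simp: semicircle_density_def indicator_def abs_square_le_1)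

lemma semicircle_density_measurable [measurable]: "semicircle_density \<in> borel_measurable borel"
  unfolding semicircle_density_def by measurable

lemma mu_c_eq: "mu_c = density lborel (\<lambda>x. ennreal (semicircle_density x))"
  by (simp add: mu_c_def semicircle_density_def)

lemma sets_mu_c [measurable_cong, simp]: "sets mu_c = sets borel"
  and space_mu_c [simp]: "space mu_c = UNIV"
  by (simp_all add: mu_c_eq)

lemma AE_mu_c_Icc: "AE x in mu_c. x \<in> {-1..1}"
  unfolding mu_c_eq
  by (subst AE_density) (auto simp: semicircle_density_def indicator_def)

text \<open>Substituting \<open>x = cos t\<close> leaves the integral of
  \<open>sin ((n + 1) t) sin t\<close> over [0, pi]. The integrand is half a difference of two
  cosines, and only for \<open>n = 0\<close> does one of them have nonzero mean.\<close>

lemma has_integral_chebU_sqrt: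
  "((\<lambda>x. chebU n x * sqrt (1 - x\<^sup>2)) has_integral (if n = 0 then pi / 2 else 0)) {-1..1}"
proof -
  \<comment> \<open>an antiderivative after the substitution \<open>x = cos t\<close>\<close>
  define G where "G t = (if n = 0 then t else sin (real n * t) / real n) / (-2)
      + sin (real (n + 2) * t) / (2 * real (n + 2))" for t
  have G: "(G has_real_derivative - sin (real (Suc n) * t) * sin t) (at t)" for t
  proof -
    have "cos (real n * t) - cos (real (n + 2) * t) = 2 * sin (real (Suc n) * t) * sin t"
    proof -
      have "real n * t = real (Suc n) * t - t" "real (n + 2) * t = real (Suc n) * t + t"
        by (simp_all add: algebra_simps)
      then show ?thesis by (simp only: cos_diff cos_add)
    qed
    moreover have "(G has_real_derivative
        (cos (real n * t)) / (-2) + cos (real (n + 2) * t) / 2) (at t)"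
      unfolding G_def
      by (cases "n = 0") (auto intro!: derivative_eq_intros simp: divide_simps add_nonneg_eq_0_iff,
          simp add: algebra_simps)
    ultimately show ?thesis by (simp add: field_simps)
  qed
  have contG: "continuous_on UNIV G"
    by (meson DERIV_isCont G continuous_at_imp_continuous_on)
  have "((\<lambda>x. chebU n x * sqrt (1 - x\<^sup>2)) has_integral G (arccos 1) - G (arccos (-1))) {-1..1}"
  \<comment> \<open>\<open>arccos\<close> is not differentiable at -1 and 1, so only continuity is
    used at the endpoints.\<close>
  proof (rule fundamental_theorem_of_calculus_interior)
    show "continuous_on {-1..1} (\<lambda>x. G (arccos x))"
      by (rule continuous_on_compose2[OF contG]) (auto intro!: continuous_intros)
    fix x :: real assume x: "x \<in> {-1<..<1}"
    have s: "sin (arccos x) = sqrt (1 - x\<^sup>2)" "sin (arccos x) > 0"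
      using x by (auto simp: sin_arccos abs_square_less_1 abs_less_iff)
    have "((\<lambda>x. G (arccos x)) has_real_derivative
        (- sin (real (Suc n) * arccos x) * sin (arccos x)) * inverse (- sqrt (1 - x\<^sup>2))) (at x)"
      using x by (intro DERIV_chain2[OF G] DERIV_arccos) auto
    also have "(- sin (real (Suc n) * arccos x) * sin (arccos x)) * inverse (- sqrt (1 - x\<^sup>2))
        = sin (real (Suc n) * arccos x)"
      using s by (simp add: field_simps)
    also have "\<dots> = chebU n x * sqrt (1 - x\<^sup>2)"
      using chebU_sin[of n "arccos x"] x s by simp
    finally show "((\<lambda>x. G (arccos x)) has_vector_derivative chebU n x * sqrt (1 - x\<^sup>2)) (at x)"
      by (simp add: has_real_derivative_iff_has_vector_derivative)
  qed simp
  moreover have "G 0 - G pi = (if n = 0 then pi / 2 else 0)"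
    using sin_npi[of n] sin_npi[of "n+2"]
    by (auto simp: G_def)
  ultimately show ?thesis by simp
qed

lemma
  fixes g :: "real \<Rightarrow> real"
  assumes "continuous_on UNIV g"
  shows integrable_mu_c_continuous: "integrable mu_c g"
    and integral_mu_c_continuous:
      "integral\<^sup>L mu_c g = 2 / pi * integral {-1..1} (\<lambda>x. g x * sqrt (1 - x\<^sup>2))"
proof -
  have [measurable]: "g \<in> borel_measurable borel"
    using assms by (rule borel_measurable_continuous_onI)
  have *: "set_integrable lborel {-1..1} (\<lambda>x. g x * sqrt (1 - x\<^sup>2))"
    by (intro borel_integrable_atLeastAtMost' continuous_intros continuous_on_subset[OF assms]) auto
  have eq: "semicircle_density x *\<^sub>R g x
      = (2 / pi) * (indicator {-1..1} x *\<^sub>R (g x * sqrt (1 - x\<^sup>2)))" for x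
    by (simp add: semicircle_density_def)
  show "integrable mu_c g"
    unfolding mu_c_eq
    by (subst integrable_density, measurable)
       (use * in \<open>auto simp only: semicircle_density_nonneg eq set_integrable_def
         intro!: integrable_mult_right\<close>)
  show "integral\<^sup>L mu_c g = 2 / pi * integral {-1..1} (\<lambda>x. g x * sqrt (1 - x\<^sup>2))"
    unfolding mu_c_eq
    by (subst integral_density, measurable)
       (use set_borel_integral_eq_integral(2)[OF *] in
        \<open>auto simp only: semicircle_density_nonneg eq set_lebesgue_integral_def
         integral_mult_right_zero\<close>)
qed

lemma integral_chebU: "(LINT x|mu_c. chebU n x) = (if n = 0 then 1 else 0)"
  using has_integral_chebU_sqrt[of n]
  by (subst integral_mu_c_continuous) (auto simp: continuous_chebU has_integral_iff)

lemma integrable_chebU_mult: "integrable mu_c (\<lambda>x. chebU m x * chebU n x)"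
  by (intro integrable_mu_c_continuous continuous_intros)

text \<open>The recurrence lowers the index \<open>m\<close>, and the factor \<open>2 x\<close> it
  produces is absorbed by \<open>chebU n\<close>. Strong induction with \<open>n\<close> free thus
  ends at \<open>m = 0\<close>, where \<open>integral_chebU\<close> applies.\<close>

lemma chebU_orthonormal:
  "(LINT x|mu_c. chebU m x * chebU n x) = (if m = n then 1 else 0)"
proof (induction m arbitrary: n rule: less_induct)
  case (less m)
  note [simp] = integrable_chebU_mult
  consider "m = 0" | "m = Suc 0" | k where "m = Suc (Suc k)"
    by (metis not0_implies_Suc)
  then show ?case
  proof cases
    case 1
    then show ?thesis by (simp add: integral_chebU)
  next
    case 2
    have "chebU m x * chebU n x = chebU 0 x * chebU (Suc n) x
        + (if n = 0 then 0 else chebU 0 x * chebU (n - 1) x)" for x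
      using mult_x_chebU[of x n] 2 by auto
    then have "(LINT x|mu_c. chebU m x * chebU n x)
        = (LINT x|mu_c. chebU 0 x * chebU (Suc n) x)
        + (if n = 0 then 0 else LINT x|mu_c. chebU 0 x * chebU (n - 1) x)"
      by (simp add: integrable_mu_c_continuous continuous_chebU del: chebU.simps)
    also have "\<dots> = (if m = n then 1 else 0)"
      using 2 by (auto simp: less simp del: chebU.simps)
    finally show ?thesis .
  next
    case (3 k)
    have "chebU m x * chebU n x = chebU (Suc k) x * chebU (Suc n) x
        + (if n = 0 then 0 else chebU (Suc k) x * chebU (n - 1) x) - chebU k x * chebU n x" for x
    proof -
      have "chebU m x * chebU n x = 2 * (x * chebU n x) * chebU (Suc k) x - chebU k x * chebU n x"
        by (simp add: 3 algebra_simps)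
      then show ?thesis
        by (cases "n = 0") (simp_all add: mult_x_chebU algebra_simps del: chebU.simps)
    qed
    then have "(LINT x|mu_c. chebU m x * chebU n x)
        = (LINT x|mu_c. chebU (Suc k) x * chebU (Suc n) x)
        + (if n = 0 then 0 else LINT x|mu_c. chebU (Suc k) x * chebU (n - 1) x)
        - (LINT x|mu_c. chebU k x * chebU n x)"
      by (simp del: chebU.simps)
    also have "\<dots> = (if m = n then 1 else 0)"
      using 3 by (auto simp: less simp del: chebU.simps)
    finally show ?thesis .
  qed
qed

lemma prob_space_mu_c: "prob_space mu_c"
proof
  have "integrable mu_c (\<lambda>_. 1 :: real)"
    by (intro integrable_mu_c_continuous continuous_intros)
  then have "emeasure mu_c (space mu_c) < \<infinity>"
    by (simp add: integrable_iff_bounded)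
  moreover have "measure mu_c (space mu_c) = 1"
    using integral_chebU[of 0] by simp
  ultimately show "emeasure mu_c (space mu_c) = 1"
    by (simp add: emeasure_eq_ennreal_measure less_top)
qed

interpretation mu_c: prob_space mu_c by (rule prob_space_mu_c)

section \<open>Chebyshev expansions in \<open>L\<^sup>2(\<mu>\<^sub>c)\<close>\<close>

lemma L2c_measurable [measurable_dest]: "f \<in> L2c \<Longrightarrow> f \<in> borel_measurable borel"
  by (simp add: L2c_def cong: measurable_cong_sets)

lemma L2cI: "f \<in> borel_measurable borel \<Longrightarrow> integrable mu_c (\<lambda>x. (cmod (f x))\<^sup>2) \<Longrightarrow> f \<in> L2c"
  by (simp add: L2c_def cong: measurable_cong_sets)

lemma L2c_integrable_sq: "f \<in> L2c \<Longrightarrow> integrable mu_c (\<lambda>x. (cmod (f x))\<^sup>2)"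
  by (simp add: L2c_def)

lemma L2c_integrable: assumes [measurable]: "f \<in> L2c" shows "integrable mu_c f"
proof (rule Bochner_Integration.integrable_bound)
  show "integrable mu_c (\<lambda>x. 1 + (cmod (f x))\<^sup>2)"
    using assms by (simp add: L2c_integrable_sq)
  have "t \<le> 1 + t\<^sup>2" for t :: real
    using zero_le_power2[of "t - 1/2"] by (simp add: power2_eq_square algebra_simps)
  then show "AE x in mu_c. norm (f x) \<le> norm (1 + (cmod (f x))\<^sup>2)"
    by (intro AE_I2) (metis abs_ge_self order_trans real_norm_def)
qed measurable

lemma cmod_lincomb_sq_le:
  "(cmod (a * u + b * v))\<^sup>2 \<le> 2 * (cmod a)\<^sup>2 * (cmod u)\<^sup>2 + 2 * (cmod b)\<^sup>2 * (cmod v)\<^sup>2"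
proof -
  have "(cmod (a * u + b * v))\<^sup>2 \<le> (cmod (a * u) + cmod (b * v))\<^sup>2"
    by (intro power_mono norm_triangle_ineq) auto
  also have "\<dots> \<le> 2 * (cmod (a * u))\<^sup>2 + 2 * (cmod (b * v))\<^sup>2"
    using zero_le_power2[of "cmod (a * u) - cmod (b * v)"]
    by (simp add: power2_eq_square algebra_simps)
  finally show ?thesis by (simp add: norm_mult power_mult_distrib)
qed

lemma L2c_lincomb:
  assumes [measurable]: "f \<in> L2c" "g \<in> L2c"
  shows "(\<lambda>x. a * f x + b * g x) \<in> L2c"
proof (rule L2cI)
  show "integrable mu_c (\<lambda>x. (cmod (a * f x + b * g x))\<^sup>2)"
  proof (rule Bochner_Integration.integrable_bound)
    show "integrable mu_c (\<lambda>x. 2 * (cmod a)\<^sup>2 * (cmod (f x))\<^sup>2 + 2 * (cmod b)\<^sup>2 * (cmod (g x))\<^sup>2)"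
      using assms by (intro Bochner_Integration.integrable_add integrable_mult_right L2c_integrable_sq)
    show "AE x in mu_c. norm ((cmod (a * f x + b * g x))\<^sup>2)
        \<le> norm (2 * (cmod a)\<^sup>2 * (cmod (f x))\<^sup>2 + 2 * (cmod b)\<^sup>2 * (cmod (g x))\<^sup>2)"
      using cmod_lincomb_sq_le by (intro AE_I2) (metis abs_ge_self abs_of_nonneg order_trans real_norm_def zero_le_power2)
  qed measurable
qed measurable

lemma L2c_add: "f \<in> L2c \<Longrightarrow> g \<in> L2c \<Longrightarrow> (\<lambda>x. f x + g x) \<in> L2c"
  using L2c_lincomb[of f g 1 1] by simp

lemma L2c_diff: "f \<in> L2c \<Longrightarrow> g \<in> L2c \<Longrightarrow> (\<lambda>x. f x - g x) \<in> L2c"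
  using L2c_lincomb[of f g 1 "-1"] by simp

lemma L2c_const: "(\<lambda>_. c) \<in> L2c"
  by (rule L2cI) auto

text \<open>A continuous \<open>p\<close> may be unbounded on the line, but \<open>mu_c\<close>
  lives on [-1,1], where compactness bounds it.\<close>

lemma L2c_mult_continuous:
  fixes p :: "real \<Rightarrow> real"
  assumes p: "continuous_on UNIV p" and [measurable]: "f \<in> L2c"
  shows "(\<lambda>x. complex_of_real (p x) * f x) \<in> L2c"
proof (rule L2cI)
  have [measurable]: "p \<in> borel_measurable borel"
    using p by (rule borel_measurable_continuous_onI)
  show "(\<lambda>x. complex_of_real (p x) * f x) \<in> borel_measurable borel" by measurable
  have "bounded (p ` {-1..1})"
    by (intro compact_imp_bounded compact_continuous_image continuous_on_subset[OF p]) auto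
  then obtain B where B: "\<And>x. x \<in> {-1..1} \<Longrightarrow> \<bar>p x\<bar> \<le> B"
    unfolding bounded_iff by (metis imageI real_norm_def)
  show "integrable mu_c (\<lambda>x. (cmod (complex_of_real (p x) * f x))\<^sup>2)"
  proof (rule Bochner_Integration.integrable_bound)
    show "integrable mu_c (\<lambda>x. B\<^sup>2 * (cmod (f x))\<^sup>2)"
      using assms by (intro integrable_mult_right L2c_integrable_sq)
    show "AE x in mu_c. norm ((cmod (complex_of_real (p x) * f x))\<^sup>2) \<le> norm (B\<^sup>2 * (cmod (f x))\<^sup>2)"
      using AE_mu_c_Icc
    proof eventually_elim
      case (elim x)
      then show ?case using B[OF elim]
        by (auto simp: norm_mult power_mult_distrib intro!: mult_right_mono)
           (metis abs_ge_zero power2_abs power_mono)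
    qed
  qed measurable
qed

lemma Mx_L2c: "f \<in> L2c \<Longrightarrow> Mx f \<in> L2c"
  unfolding Mx_def by (intro L2c_mult_continuous) auto

section \<open>Chebyshev coefficients and their completeness\<close>

definition cheb_coef :: "(real \<Rightarrow> complex) \<Rightarrow> nat \<Rightarrow> complex" where
  "cheb_coef f n = (LINT x|mu_c. complex_of_real (chebU n x) * f x)"

lemma integrable_chebU_L2c: "f \<in> L2c \<Longrightarrow> integrable mu_c (\<lambda>x. complex_of_real (chebU n x) * f x)"
  by (intro L2c_integrable L2c_mult_continuous continuous_chebU)

lemma cheb_coef_lincomb:
  assumes "f \<in> L2c" "g \<in> L2c"
  shows "cheb_coef (\<lambda>x. a * f x + b * g x) n = a * cheb_coef f n + b * cheb_coef g n"
proof -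
  have "cheb_coef (\<lambda>x. a * f x + b * g x) n
      = (LINT x|mu_c. a * (complex_of_real (chebU n x) * f x) + b * (complex_of_real (chebU n x) * g x))"
    unfolding cheb_coef_def by (simp add: algebra_simps)
  also have "\<dots> = a * cheb_coef f n + b * cheb_coef g n"
    unfolding cheb_coef_def using assms
    by (subst Bochner_Integration.integral_add) (auto intro: integrable_chebU_L2c)
  finally show ?thesis .
qed

lemma cheb_coef_diff:
  "f \<in> L2c \<Longrightarrow> g \<in> L2c \<Longrightarrow> cheb_coef (\<lambda>x. f x - g x) n = cheb_coef f n - cheb_coef g n"
  using cheb_coef_lincomb[of f g 1 "-1"] by simp

text \<open>The recurrence \<open>mult_x_chebU\<close> integrated against \<open>f\<close>: on
  coefficients, \<open>Mx\<close> is half the sum of the shift and its adjoint.\<close>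

lemma cheb_coef_Mx:
  assumes "f \<in> L2c"
  shows "cheb_coef (Mx f) n
      = (cheb_coef f (Suc n) + (if n = 0 then 0 else cheb_coef f (n - 1))) / 2"
proof -
  have "complex_of_real (chebU n x) * Mx f x = (complex_of_real (chebU (Suc n) x) * f x
      + (if n = 0 then 0 else complex_of_real (chebU (n - 1) x) * f x)) / 2" for x
  proof -
    have "complex_of_real (chebU n x) * Mx f x = complex_of_real (x * chebU n x) * f x"
      by (simp add: Mx_def)
    then show ?thesis unfolding mult_x_chebU by (simp add: algebra_simps add_divide_distrib)
  qed
  then show ?thesis
    unfolding cheb_coef_def using assms
    by (cases "n = 0") (simp_all only: integrable_chebU_L2c Bochner_Integration.integral_add
      integral_divide_zero if_True if_False simp_thms add_0_right)
qed

lemma cheb_coef_chebU: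
  "cheb_coef (\<lambda>x. c * complex_of_real (chebU m x)) n = (if m = n then c else 0)"
proof -
  have "cheb_coef (\<lambda>x. c * complex_of_real (chebU m x)) n
      = (LINT x|mu_c. c * complex_of_real (chebU m x * chebU n x))"
    unfolding cheb_coef_def by (simp add: algebra_simps)
  also have "\<dots> = c * complex_of_real (LINT x|mu_c. chebU m x * chebU n x)"
    by (simp only: integral_mult_right_zero integral_complex_of_real)
  finally show ?thesis by (simp add: chebU_orthonormal)
qed

lemma cheb_coef_const: "cheb_coef (\<lambda>_. c) n = (if n = 0 then c else 0)"
  using cheb_coef_chebU[of c 0 n] by auto

lemma L2c_chebU: "(\<lambda>x. c * complex_of_real (chebU m x)) \<in> L2c"
  using L2c_mult_continuous[OF continuous_chebU L2c_const[of c]] by (simp add: mult.commute)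

text \<open>Weierstrass approximation on [-1,1] passes from monomials to continuous test functions,
  ramps pass from those to indicators of rays, and rays determine a finite measure.\<close>

lemma AE_zero_of_moments_zero:
  fixes h :: "real \<Rightarrow> real"
  assumes h: "integrable mu_c h" and pow: "\<And>n. integrable mu_c (\<lambda>x. x ^ n * h x)"
    and mom: "\<And>n. (LINT x|mu_c. x ^ n * h x) = 0"
  shows "AE x in mu_c. h x = 0"
proof -
  have [measurable]: "h \<in> borel_measurable borel"
    using borel_measurable_integrable[OF h] by (simp cong: measurable_cong_sets)
  have cont: "(LINT x|mu_c. g x * h x) = 0" if g: "continuous_on UNIV g" for g :: "real \<Rightarrow> real"
  proof -
    have [measurable]: "g \<in> borel_measurable borel"
      using g by (rule borel_measurable_continuous_onI)
    \<comment> \<open>A bound on [-1,1] alone controls the integral; it is applied to the error of a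
      polynomial approximation.\<close>
    have bdd: "integrable mu_c (\<lambda>x. q x * h x) \<and> \<bar>LINT x|mu_c. q x * h x\<bar> \<le> e * (LINT x|mu_c. \<bar>h x\<bar>)"
      if q [measurable]: "q \<in> borel_measurable borel" and e: "\<And>x. x \<in> {-1..1} \<Longrightarrow> \<bar>q x\<bar> \<le> e" for q e
    proof -
      have b: "AE x in mu_c. \<bar>q x * h x\<bar> \<le> e * \<bar>h x\<bar>"
        using AE_mu_c_Icc by eventually_elim (auto simp: abs_mult intro!: mult_right_mono e)
      have i: "integrable mu_c (\<lambda>x. q x * h x)"
        by (rule Bochner_Integration.integrable_bound[where f = "\<lambda>x. e * \<bar>h x\<bar>"])
           (use h b in \<open>auto elim!: eventually_mono\<close>)
      have "\<bar>LINT x|mu_c. q x * h x\<bar> \<le> (LINT x|mu_c. \<bar>q x * h x\<bar>)"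
        by (rule integral_abs_bound)
      also have "\<dots> \<le> (LINT x|mu_c. e * \<bar>h x\<bar>)"
        using i h b by (intro integral_mono_AE) auto
      finally show ?thesis using i by simp
    qed
    have "\<bar>LINT x|mu_c. g x * h x\<bar> \<le> e * (LINT x|mu_c. \<bar>h x\<bar>)" if e0: "e > 0" for e
    proof -
      obtain p where p: "real_polynomial_function p" "\<And>x. x \<in> {-1..1} \<Longrightarrow> \<bar>g x - p x\<bar> < e"
        by (rule Stone_Weierstrass_real_polynomial_function[of "{-1..1}" g e])
           (use e0 continuous_on_subset[OF g] in auto)
      obtain a n where a: "p = (\<lambda>x. \<Sum>i\<le>n. a i * x ^ i)"
        using p(1) real_polynomial_function_iff_sum by blast
      have "(LINT x|mu_c. p x * h x) = (LINT x|mu_c. (\<Sum>i\<le>n. a i * (x ^ i * h x)))"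
        by (simp add: a sum_distrib_right mult.assoc)
      also have "\<dots> = 0" using pow mom by (subst Bochner_Integration.integral_sum) auto
      finally have p0: "(LINT x|mu_c. p x * h x) = 0" .
      have ip: "integrable mu_c (\<lambda>x. p x * h x)"
        using pow by (simp add: a sum_distrib_right mult.assoc)
      have [measurable]: "p \<in> borel_measurable borel"
        unfolding a by measurable
      have d: "integrable mu_c (\<lambda>x. (g x - p x) * h x)"
          "\<bar>LINT x|mu_c. (g x - p x) * h x\<bar> \<le> e * (LINT x|mu_c. \<bar>h x\<bar>)"
        using bdd[of "\<lambda>x. g x - p x" e] p(2) by (auto intro: less_imp_le)
      have "(LINT x|mu_c. g x * h x) = (LINT x|mu_c. (g x - p x) * h x + p x * h x)"
        by (simp add: algebra_simps)
      also have "\<dots> = (LINT x|mu_c. (g x - p x) * h x)"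
        using d ip p0 by (subst Bochner_Integration.integral_add) auto
      finally show ?thesis using d by simp
    qed
    \<comment> \<open>The estimate holds for every positive \<open>e\<close>, so let
      \<open>e\<close> tend to 0 from the right.\<close>
    then have "eventually (\<lambda>e. \<bar>LINT x|mu_c. g x * h x\<bar> \<le> e * (LINT x|mu_c. \<bar>h x\<bar>)) (at_right 0)"
      by (auto simp: eventually_at_filter)
    moreover have "((\<lambda>e. e * (LINT x|mu_c. \<bar>h x\<bar>)) \<longlongrightarrow> 0 * (LINT x|mu_c. \<bar>h x\<bar>)) (at_right 0)"
      by (intro tendsto_intros)
    ultimately have "\<bar>LINT x|mu_c. g x * h x\<bar> \<le> 0 * (LINT x|mu_c. \<bar>h x\<bar>)"
      by (intro tendsto_lowerbound) auto
    then show ?thesis by simp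
  qed
  have ray: "(LINT x|mu_c. indicator {a<..} x * h x) = 0" for a
  proof -
    \<comment> \<open>Continuous ramps of slope \<open>k\<close> starting at \<open>a\<close>; they
      take values in [0,1], so the absolute value of \<open>h\<close> dominates.\<close>
    define g where "g k x = max 0 (min 1 (real k * (x - a)))" for k x
    have lim: "(\<lambda>k. g k x) \<longlonglongrightarrow> indicator {a<..} x" for x
    proof (cases "x > a")
      case True
      obtain K where K: "real K * (x - a) > 1"
        using True reals_Archimedean3[of "x - a"] by auto
      have "eventually (\<lambda>k. g k x = 1) sequentially"
        using eventually_ge_at_top[of K]
      proof eventually_elim
        case (elim k)
        then have "real K * (x - a) \<le> real k * (x - a)"
          using True by (intro mult_right_mono) auto
        then show ?case using K by (simp add: g_def)
      qed
      then show ?thesis using True by (simp add: tendsto_eventually)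
    next
      case False
      then have "real k * (x - a) \<le> 0" for k by (simp add: mult_nonneg_nonpos)
      then have "g k x = 0" for k
        unfolding g_def by (intro max_absorb1) (simp add: min_le_iff_disj)
      then show ?thesis using False by simp
    qed
    have "(\<lambda>k. LINT x|mu_c. g k x * h x) \<longlonglongrightarrow> (LINT x|mu_c. indicator {a<..} x * h x)"
    proof (rule integral_dominated_convergence[where w = "\<lambda>x. \<bar>h x\<bar>"])
      show "AE x in mu_c. (\<lambda>k. g k x * h x) \<longlonglongrightarrow> indicator {a<..} x * h x"
        by (intro AE_I2 tendsto_mult lim tendsto_const)
      show "AE x in mu_c. norm (g k x * h x) \<le> \<bar>h x\<bar>" for k
        by (intro AE_I2) (auto simp: g_def abs_mult intro!: mult_left_le_one_le)
    qed (use h in \<open>auto simp: g_def\<close>)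
    moreover have "(LINT x|mu_c. g k x * h x) = 0" for k
      unfolding g_def by (intro cont continuous_intros)
    ultimately show ?thesis by (simp add: LIMSEQ_const_iff)
  qed
  \<comment> \<open>The positive and negative parts of \<open>h\<close> define measures that agree on all rays.\<close>
  define M where "M s = density mu_c (\<lambda>x. ennreal (s * h x))" for s
  have M: "emeasure (M s) {a<..} = ennreal (LINT x|mu_c. max 0 (s * h x) * indicator {a<..} x)" for s a
  proof -
    have "emeasure (M s) {a<..} = (\<integral>\<^sup>+x. ennreal (max 0 (s * h x) * indicator {a<..} x) \<partial>mu_c)"
      unfolding M_def by (subst emeasure_density)
        (auto intro!: nn_integral_cong simp: indicator_def max_def ennreal_neg)
    also have "\<dots> = ennreal (LINT x|mu_c. max 0 (s * h x) * indicator {a<..} x)"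
      by (intro nn_integral_eq_integral) (use h in \<open>auto intro!: integrable_real_mult_indicator\<close>)
    finally show ?thesis .
  qed
  have "M 1 = M (-1)"
  proof (rule measure_eqI_lessThan)
    fix a
    have "(LINT x|mu_c. max 0 (1 * h x) * indicator {a<..} x)
        - (LINT x|mu_c. max 0 ((-1) * h x) * indicator {a<..} x)
        = (LINT x|mu_c. max 0 (1 * h x) * indicator {a<..} x - max 0 ((-1) * h x) * indicator {a<..} x)"
      by (intro Bochner_Integration.integral_diff[symmetric])
         (use h in \<open>auto intro!: integrable_real_mult_indicator\<close>)
    also have "\<dots> = (LINT x|mu_c. indicator {a<..} x * h x)"
      by (intro Bochner_Integration.integral_cong) (auto simp: indicator_def max_def)
    finally show "emeasure (M 1) {a<..} = emeasure (M (-1)) {a<..}"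
      by (simp only: M ray right_minus_eq)
    show "emeasure (M 1) {a<..} < \<infinity>" by (simp only: M) simp
  qed (simp_all add: M_def)
  then have "AE x in mu_c. ennreal (1 * h x) = ennreal (-1 * h x)"
    unfolding M_def by (subst (asm) mu_c.density_unique_iff) auto
  then show ?thesis
  proof eventually_elim
    case (elim x)
    \<comment> \<open>\<open>ennreal\<close> truncates negative numbers to 0, so one of the two
      sides is 0; being equal, both are, and \<open>h x\<close> is neither positive nor
      negative.\<close>
    have "ennreal (h x) = 0 \<or> ennreal (- h x) = 0" by (simp add: ennreal_eq_0_iff linear)
    with elim have "ennreal (h x) = 0 \<and> ennreal (- h x) = 0" by (metis mult_1 mult_minus1)
    then show ?case by (simp add: ennreal_eq_0_iff)
  qed
qed

text \<open>By the recurrence, vanishing coefficients are inherited by \<open>x ^ k * f\<close>.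
  Since \<open>chebU 0\<close> is 1, the zeroth coefficients of these products are the moments,
  which vanish for the real and imaginary parts separately.\<close>

lemma cheb_coef_complete:
  assumes f: "f \<in> L2c" and zero: "\<And>n. cheb_coef f n = 0"
  shows "AE x in mu_c. f x = 0"
proof -
  have pw: "(\<lambda>x. complex_of_real (x ^ k) * f x) \<in> L2c" for k
    by (intro L2c_mult_continuous f continuous_intros)
  have "cheb_coef (\<lambda>x. complex_of_real (x ^ k) * f x) n = 0" for k n
  proof (induction k arbitrary: n)
    case 0
    then show ?case using zero by simp
  next
    case (Suc k)
    have "(\<lambda>x. complex_of_real (x ^ Suc k) * f x) = Mx (\<lambda>x. complex_of_real (x ^ k) * f x)"
      by (simp add: Mx_def fun_eq_iff)
    then show ?case using cheb_coef_Mx[OF pw[of k], of n] Suc by (simp only:) simp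
  qed
  from this[of _ 0] have m: "(LINT x|mu_c. complex_of_real (x ^ k) * f x) = 0" for k
    by (simp add: cheb_coef_def)
  have "AE x in mu_c. Re (f x) = 0"
  proof (rule AE_zero_of_moments_zero)
    fix k
    show "(LINT x|mu_c. x ^ k * Re (f x)) = 0"
      using integral_Re[OF L2c_integrable[OF pw[of k]]] m[of k] by simp
    show "integrable mu_c (\<lambda>x. x ^ k * Re (f x))"
      using integrable_Re[OF L2c_integrable[OF pw[of k]]] by simp
  qed (use L2c_integrable[OF f] in auto)
  moreover have "AE x in mu_c. Im (f x) = 0"
  proof (rule AE_zero_of_moments_zero)
    fix k
    show "(LINT x|mu_c. x ^ k * Im (f x)) = 0"
      using integral_Im[OF L2c_integrable[OF pw[of k]]] m[of k] by simp
    show "integrable mu_c (\<lambda>x. x ^ k * Im (f x))"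
      using integrable_Im[OF L2c_integrable[OF pw[of k]]] by simp
  qed (use L2c_integrable[OF f] in auto)
  ultimately show ?thesis by eventually_elim (simp add: complex_eq_iff)
qed

lemma cheb_coef_eq_AE:
  assumes "f \<in> L2c" "g \<in> L2c" "\<And>n. cheb_coef f n = cheb_coef g n"
  shows "AE x in mu_c. f x = g x"
  using cheb_coef_complete[OF L2c_diff[OF assms(1,2)]] assms by (simp add: cheb_coef_diff)

section \<open>Partial sums, Bessel, Riesz-Fischer and Parseval\<close>

definition cheb_sum :: "(nat \<Rightarrow> complex) \<Rightarrow> nat \<Rightarrow> real \<Rightarrow> complex" where
  "cheb_sum a M x = (\<Sum>m<M. a m * complex_of_real (chebU m x))"

lemma cheb_sum_Suc: "cheb_sum a (Suc M) x = cheb_sum a M x + a M * complex_of_real (chebU M x)"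
  by (simp add: cheb_sum_def)

lemma cheb_sum_L2c: "cheb_sum a M \<in> L2c"
proof (induction M)
  case 0
  then show ?case using L2c_const[of 0] by (simp add: cheb_sum_def[abs_def])
next
  case (Suc M)
  then show ?case
    using L2c_add[OF Suc L2c_chebU[of "a M" M]] by (simp add: cheb_sum_Suc[abs_def])
qed

lemma cheb_coef_cheb_sum: "cheb_coef (cheb_sum a M) n = (if n < M then a n else 0)"
proof (induction M)
  case 0
  then show ?case using cheb_coef_const[of 0 n] by (simp add: cheb_sum_def[abs_def])
next
  case (Suc M)
  have "cheb_coef (cheb_sum a (Suc M)) n
      = cheb_coef (cheb_sum a M) n + cheb_coef (\<lambda>x. a M * complex_of_real (chebU M x)) n"
    using cheb_coef_lincomb[OF cheb_sum_L2c[of a M] L2c_chebU[of "a M" M], of 1 1 n]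
    by (simp add: cheb_sum_Suc[abs_def])
  then show ?case by (auto simp: Suc cheb_coef_chebU)
qed

lemma sq_dist_chebU:
  assumes g: "g \<in> L2c"
  shows "(LINT x|mu_c. (cmod (g x - a * complex_of_real (chebU m x)))\<^sup>2)
    = (LINT x|mu_c. (cmod (g x))\<^sup>2) - 2 * Re (cnj a * cheb_coef g m) + (cmod a)\<^sup>2"
proof -
  have eq: "(cmod (g x - a * complex_of_real (chebU m x)))\<^sup>2
      = ((cmod (g x))\<^sup>2 - 2 * Re (cnj a * (complex_of_real (chebU m x) * g x)))
        + (cmod a)\<^sup>2 * (chebU m x * chebU m x)" for x
    by (simp add: cmod_power2) (simp add: power2_eq_square algebra_simps)
  have i: "integrable mu_c (\<lambda>x. cnj a * (complex_of_real (chebU m x) * g x))"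
    using g by (simp add: integrable_chebU_L2c)
  have "(LINT x|mu_c. Re (cnj a * (complex_of_real (chebU m x) * g x))) = Re (cnj a * cheb_coef g m)"
    unfolding cheb_coef_def using integral_Re[OF i] by simp
  moreover have "integrable mu_c (\<lambda>x. 2 * Re (cnj a * (complex_of_real (chebU m x) * g x)))"
    by (intro integrable_mult_right integrable_Re i)
  moreover have "integrable mu_c (\<lambda>x. (cmod a)\<^sup>2 * (chebU m x * chebU m x))"
    by (intro integrable_mult_right integrable_chebU_mult)
  ultimately show ?thesis
    unfolding eq
    by (simp only: Bochner_Integration.integral_add Bochner_Integration.integral_diff
        Bochner_Integration.integrable_diff L2c_integrable_sq[OF g] integral_mult_right_zero
        chebU_orthonormal) simp
qed

text \<open>The coefficients \<open>a\<close> are arbitrary, so one identity serves several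
  purposes: those of \<open>f\<close> give Bessel, \<open>f = 0\<close> gives the norm of a partial
  sum, and a longer partial sum as \<open>f\<close> gives the Cauchy estimate.\<close>

lemma sq_dist_cheb_sum:
  assumes "f \<in> L2c"
  shows "(LINT x|mu_c. (cmod (f x - cheb_sum a M x))\<^sup>2)
    = (LINT x|mu_c. (cmod (f x))\<^sup>2) - 2 * (\<Sum>m<M. Re (cnj (a m) * cheb_coef f m))
      + (\<Sum>m<M. (cmod (a m))\<^sup>2)"
proof (induction M)
  case 0
  then show ?case by (simp add: cheb_sum_def)
next
  case (Suc M)
  have "f x - cheb_sum a (Suc M) x = (f x - cheb_sum a M x) - a M * complex_of_real (chebU M x)" for x
    by (simp add: cheb_sum_Suc)
  then have "(LINT x|mu_c. (cmod (f x - cheb_sum a (Suc M) x))\<^sup>2)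
      = (LINT x|mu_c. (cmod (f x - cheb_sum a M x - a M * complex_of_real (chebU M x)))\<^sup>2)"
    by (simp only:)
  \<comment> \<open>The remainder has the same coefficient at \<open>M\<close> as \<open>f\<close>,
    because \<open>cheb_sum a M\<close> stops before index \<open>M\<close>.\<close>
  then show ?case
    using sq_dist_chebU[OF L2c_diff[OF assms cheb_sum_L2c], of a M "a M" M] Suc
    by (simp add: cheb_coef_diff assms cheb_sum_L2c cheb_coef_cheb_sum)
qed

lemma Re_cnj_mult_self: "Re (cnj z * z) = (cmod z)\<^sup>2"
  by (simp add: cmod_power2) (simp add: power2_eq_square)

lemma cheb_bessel:
  assumes "f \<in> L2c"
  shows "(\<Sum>m<M. (cmod (cheb_coef f m))\<^sup>2) \<le> (LINT x|mu_c. (cmod (f x))\<^sup>2)"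
proof -
  have "0 \<le> (LINT x|mu_c. (cmod (f x - cheb_sum (cheb_coef f) M x))\<^sup>2)" by simp
  then show ?thesis
    using sq_dist_cheb_sum[OF assms, of "cheb_coef f" M] by (simp only: Re_cnj_mult_self)
qed

lemma cheb_coef_sq_summable:
  assumes "f \<in> L2c" shows "summable (\<lambda>m. (cmod (cheb_coef f m))\<^sup>2)"
  using cheb_bessel[OF assms] by (intro summableI_nonneg_bounded) auto

lemma sq_dist_cheb_sums:
  assumes "K \<le> M"
  shows "(LINT x|mu_c. (cmod (cheb_sum a M x - cheb_sum a K x))\<^sup>2)
    = (\<Sum>m<M. (cmod (a m))\<^sup>2) - (\<Sum>m<K. (cmod (a m))\<^sup>2)"
proof -
  have "(LINT x|mu_c. (cmod (cheb_sum a M x))\<^sup>2) = (\<Sum>m<M. (cmod (a m))\<^sup>2)"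
    using sq_dist_cheb_sum[OF L2c_const[of 0], of a M] by (simp add: cheb_coef_const)
  moreover have "(\<Sum>m<K. Re (cnj (a m) * cheb_coef (cheb_sum a M) m)) = (\<Sum>m<K. (cmod (a m))\<^sup>2)"
    using assms by (intro sum.cong) (auto simp only: cheb_coef_cheb_sum lessThan_iff
      less_le_trans if_True Re_cnj_mult_self)
  ultimately show ?thesis
    using sq_dist_cheb_sum[OF cheb_sum_L2c, of a M a K] by simp
qed

text \<open>This is nonnegativity of the variance of the modulus of \<open>f\<close> under a
  probability measure.\<close>

lemma L2c_integral_norm_le:
  assumes "f \<in> L2c"
  shows "(LINT x|mu_c. cmod (f x)) \<le> sqrt (LINT x|mu_c. (cmod (f x))\<^sup>2)"
proof (rule real_le_rsqrt)
  show "(LINT x|mu_c. cmod (f x))\<^sup>2 \<le> (LINT x|mu_c. (cmod (f x))\<^sup>2)"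
    using mu_c.variance_positive[of "\<lambda>x. cmod (f x)"]
      mu_c.variance_eq[of "\<lambda>x. cmod (f x)"] L2c_integrable[OF assms] L2c_integrable_sq[OF assms]
    by simp
qed

text \<open>The partial sums are Cauchy; a fast subsequence converges almost everywhere, Fatou's
  lemma bounds the distance from its limit to each partial sum by the tail \<open>e M\<close>, and
  Bessel then identifies the coefficients.\<close>

theorem cheb_riesz_fischer:
  assumes a: "summable (\<lambda>m. (cmod (a m))\<^sup>2)"
  obtains f where "f \<in> L2c" "\<And>n. cheb_coef f n = a n"
    "(LINT x|mu_c. (cmod (f x))\<^sup>2) = (\<Sum>m. (cmod (a m))\<^sup>2)"
proof -
  define S where "S = (\<Sum>m. (cmod (a m))\<^sup>2)"
  define e where "e M = S - (\<Sum>m<M. (cmod (a m))\<^sup>2)" for M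
  have e0: "e \<longlonglongrightarrow> 0"
    unfolding e_def[abs_def] S_def using summable_LIMSEQ[OF a] by (auto intro: tendsto_eq_intros)
  have e_nonneg: "e M \<ge> 0" for M
    unfolding e_def S_def using sum_le_suminf[OF a, of "{..<M}"] by simp
  have dist: "(LINT x|mu_c. (cmod (cheb_sum a M x - cheb_sum a K x))\<^sup>2) \<le> e K" if "K \<le> M" for K M
    using sq_dist_cheb_sums[OF that, of a] e_nonneg[of M] by (simp add: e_def)
  \<comment> \<open>\<open>e\<close> bounds squared distances, so powers of 1/4 give norms below
    powers of 1/2, which are summable.\<close>
  have "\<exists>K. \<forall>M\<ge>K. e M \<le> (1/4) ^ k" for k :: nat
    using order_tendstoD(2)[OF e0, of "(1/4)^k"] by (auto simp: eventually_sequentially intro: less_imp_le)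
  then obtain K where K: "\<And>k M. M \<ge> K k \<Longrightarrow> e M \<le> (1/4) ^ k" by metis
  \<comment> \<open>This choice is monotone, dominates \<open>K k\<close>, and tends to infinity
    with \<open>k\<close>, all at once.\<close>
  define r where "r k = k + (\<Sum>i\<le>k. K i)" for k
  have r_ge: "r k \<ge> K k" "r k \<ge> k" "r k \<le> r (Suc k)" for k
    by (auto simp: r_def intro!: trans_le_add2 member_le_sum)
  define s where "s k = cheb_sum a (r k)" for k
  have s_L2c [measurable]: "s k \<in> L2c" for k by (simp add: s_def cheb_sum_L2c)
  define d where "d k x = s (Suc k) x - s k x" for k x
  have d_L2c [measurable]: "d k \<in> L2c" for k
    unfolding d_def[abs_def] by (intro L2c_diff s_L2c)
  have d_int: "(LINT x|mu_c. cmod (d k x)) \<le> (1/2) ^ k" for k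
  proof -
    have "(LINT x|mu_c. (cmod (d k x))\<^sup>2) \<le> (1/4) ^ k"
      using dist[OF r_ge(3)[of k]] K[OF r_ge(1)[of k]] by (simp add: d_def s_def)
    then have "sqrt (LINT x|mu_c. (cmod (d k x))\<^sup>2) \<le> sqrt ((1/4) ^ k)" by simp
    also have "sqrt ((1/4) ^ k) = (1/2) ^ k"
      by (simp add: real_sqrt_power real_sqrt_divide)
    finally show ?thesis using L2c_integral_norm_le[OF d_L2c[of k]] by linarith
  qed
  \<comment> \<open>The increments have summable integrals, so almost everywhere their series
    converges absolutely and the subsequence, its telescoped form, converges.\<close>
  have "(\<integral>\<^sup>+x. (\<Sum>k. ennreal (cmod (d k x))) \<partial>mu_c) = (\<Sum>k. \<integral>\<^sup>+x. ennreal (cmod (d k x)) \<partial>mu_c)"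
    by (rule nn_integral_suminf) measurable
  also have "\<dots> = (\<Sum>k. ennreal (LINT x|mu_c. cmod (d k x)))"
    by (intro suminf_cong nn_integral_eq_integral integrable_norm L2c_integrable d_L2c) auto
  also have "\<dots> \<le> (\<Sum>k. ennreal ((1/2) ^ k))"
    by (intro suminf_le ennreal_leI d_int) auto
  also have "\<dots> = ennreal (\<Sum>k. (1/2) ^ k)"
    by (intro suminf_ennreal2) (auto intro: summable_geometric)
  finally have "(\<integral>\<^sup>+x. (\<Sum>k. ennreal (cmod (d k x))) \<partial>mu_c) \<noteq> \<infinity>"
    by (auto simp: top_unique)
  then have "AE x in mu_c. (\<Sum>k. ennreal (cmod (d k x))) \<noteq> \<infinity>"
    by (intro nn_integral_PInf_AE) measurable
  then have conv: "AE x in mu_c. convergent (\<lambda>k. s k x)"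
  proof eventually_elim
    case (elim x)
    then have "summable (\<lambda>k. cmod (d k x))"
      by (intro summable_suminf_not_top) auto
    then have "summable (\<lambda>k. d k x)" by (rule summable_norm_cancel)
    then have "convergent (\<lambda>k. \<Sum>i<k. d i x)" by (simp add: summable_iff_convergent)
    moreover have "(\<Sum>i<k. d i x) = s k x - s 0 x" for k
      unfolding d_def by (rule sum_lessThan_telescope)
    ultimately have "convergent (\<lambda>k. s k x - s 0 x)" by simp
    from convergent_add[OF this convergent_const[of "s 0 x"]] show ?case by simp
  qed
  \<comment> \<open>Off the convergence set \<open>lim\<close> is an unspecified value; that set is
    null and \<open>f\<close> is still measurable.\<close>
  define f where "f x = lim (\<lambda>k. s k x)" for x
  have f_meas [measurable]: "f \<in> borel_measurable borel"
    unfolding f_def by measurable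
  have lim: "AE x in mu_c. (\<lambda>k. s k x) \<longlonglongrightarrow> f x"
    using conv by eventually_elim (simp add: f_def convergent_LIMSEQ_iff)
  \<comment> \<open>Besides the distance bound, the case \<open>M = 0\<close> yields
    square-integrability of \<open>f\<close>.\<close>
  have fatou: "(\<integral>\<^sup>+x. ennreal ((cmod (f x - cheb_sum a M x))\<^sup>2) \<partial>mu_c) \<le> ennreal (e M)" for M
  proof -
    note cheb_sum_L2c [measurable]
    have "(\<integral>\<^sup>+x. ennreal ((cmod (f x - cheb_sum a M x))\<^sup>2) \<partial>mu_c)
        = (\<integral>\<^sup>+x. liminf (\<lambda>k. ennreal ((cmod (s k x - cheb_sum a M x))\<^sup>2)) \<partial>mu_c)"
    proof (rule nn_integral_cong_AE)
      show "AE x in mu_c. ennreal ((cmod (f x - cheb_sum a M x))\<^sup>2)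
          = liminf (\<lambda>k. ennreal ((cmod (s k x - cheb_sum a M x))\<^sup>2))"
        using lim
      proof eventually_elim
        case (elim x)
        have "(\<lambda>k. ennreal ((cmod (s k x - cheb_sum a M x))\<^sup>2))
            \<longlonglongrightarrow> ennreal ((cmod (f x - cheb_sum a M x))\<^sup>2)"
          by (intro tendsto_ennrealI tendsto_intros elim)
        from lim_imp_Liminf[OF _ this] show ?case by simp
      qed
    qed
    also have "\<dots> \<le> liminf (\<lambda>k. \<integral>\<^sup>+x. ennreal ((cmod (s k x - cheb_sum a M x))\<^sup>2) \<partial>mu_c)"
      by (rule nn_integral_liminf) measurable
    also have "\<dots> \<le> limsup (\<lambda>k. \<integral>\<^sup>+x. ennreal ((cmod (s k x - cheb_sum a M x))\<^sup>2) \<partial>mu_c)"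
      by (rule Liminf_le_Limsup) simp
    also have "\<dots> \<le> ennreal (e M)"
    proof (rule Limsup_bounded)
      show "\<forall>\<^sub>F k in sequentially.
          (\<integral>\<^sup>+x. ennreal ((cmod (s k x - cheb_sum a M x))\<^sup>2) \<partial>mu_c) \<le> ennreal (e M)"
        using eventually_ge_at_top[of M]
      proof eventually_elim
        case (elim k)
        have "(\<integral>\<^sup>+x. ennreal ((cmod (s k x - cheb_sum a M x))\<^sup>2) \<partial>mu_c)
            = ennreal (LINT x|mu_c. (cmod (s k x - cheb_sum a M x))\<^sup>2)"
          by (intro nn_integral_eq_integral L2c_integrable_sq L2c_diff s_L2c cheb_sum_L2c) auto
        also have "\<dots> \<le> ennreal (e M)"
          unfolding s_def using elim r_ge(2)[of k] by (intro ennreal_leI dist) linarith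
        finally show ?case .
      qed
    qed
    finally show ?thesis .
  qed
  have f: "f \<in> L2c"
  proof (rule L2cI)
    have "(\<integral>\<^sup>+x. ennreal ((cmod (f x))\<^sup>2) \<partial>mu_c) < \<infinity>"
      using fatou[of 0] by (simp add: cheb_sum_def) (metis ennreal_less_top le_less_trans)
    then show "integrable mu_c (\<lambda>x. (cmod (f x))\<^sup>2)"
      by (intro integrableI_nonneg) auto
  qed measurable
  have dist_f: "(LINT x|mu_c. (cmod (f x - cheb_sum a M x))\<^sup>2) \<le> e M" for M
  proof -
    have "ennreal (LINT x|mu_c. (cmod (f x - cheb_sum a M x))\<^sup>2) \<le> ennreal (e M)"
      using fatou[of M] nn_integral_eq_integral[OF L2c_integrable_sq[OF L2c_diff[OF f cheb_sum_L2c[of a M]]]]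
      by simp
    then show ?thesis using e_nonneg by (simp add: ennreal_le_iff)
  qed
  have coef: "cheb_coef f n = a n" for n
  proof -
    \<comment> \<open>For \<open>M > n\<close> this difference is a coefficient of
      \<open>f - cheb_sum a M\<close>, so Bessel bounds it by \<open>e M\<close>, which tends to
      0.\<close>
    have "(cmod (cheb_coef f n - a n))\<^sup>2 \<le> e M" if "M > n" for M
    proof -
      have "cheb_coef f n - a n = cheb_coef (\<lambda>x. f x - cheb_sum a M x) n"
        using that by (simp add: cheb_coef_diff f cheb_sum_L2c cheb_coef_cheb_sum)
      then have "(cmod (cheb_coef f n - a n))\<^sup>2
          \<le> (\<Sum>m<Suc n. (cmod (cheb_coef (\<lambda>x. f x - cheb_sum a M x) m))\<^sup>2)"
        by (simp add: sum_nonneg)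
      also have "\<dots> \<le> (LINT x|mu_c. (cmod (f x - cheb_sum a M x))\<^sup>2)"
        by (intro cheb_bessel L2c_diff f cheb_sum_L2c)
      finally show ?thesis using dist_f[of M] by linarith
    qed
    then have "(cmod (cheb_coef f n - a n))\<^sup>2 \<le> 0"
      by (intro tendsto_lowerbound[OF e0]) (auto simp: eventually_at_top_dense)
    then show ?thesis by simp
  qed
  have "(LINT x|mu_c. (cmod (f x))\<^sup>2) = S"
  proof -
    have "(LINT x|mu_c. (cmod (f x - cheb_sum a M x))\<^sup>2) = (LINT x|mu_c. (cmod (f x))\<^sup>2) - S + e M" for M
      using sq_dist_cheb_sum[OF f, of a M] unfolding coef Re_cnj_mult_self by (simp add: e_def)
    \<comment> \<open>The squared distance lies between 0 and \<open>e M\<close>, which places the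
      squared norm of \<open>f\<close> between \<open>S - e M\<close> and \<open>S\<close>.\<close>
    then have bounds: "(LINT x|mu_c. (cmod (f x))\<^sup>2) \<le> S" "S - e M \<le> (LINT x|mu_c. (cmod (f x))\<^sup>2)" for M
      using dist_f[of M]
        Bochner_Integration.integral_nonneg[of mu_c "\<lambda>x. (cmod (f x - cheb_sum a M x))\<^sup>2"]
      by simp_all
    have "(\<lambda>M. S - e M) \<longlonglongrightarrow> S"
      using e0 by (auto intro!: tendsto_eq_intros)
    then have "S \<le> (LINT x|mu_c. (cmod (f x))\<^sup>2)"
      by (rule LIMSEQ_le_const2) (use bounds in blast)
    with bounds show ?thesis by simp
  qed
  with f coef show ?thesis using that S_def by auto
qed

text \<open>The Riesz-Fischer function with the coefficients of \<open>f\<close> has the required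
  norm, and completeness identifies it with \<open>f\<close> almost everywhere.\<close>

lemma cheb_parseval:
  assumes f: "f \<in> L2c"
  shows "(LINT x|mu_c. (cmod (f x))\<^sup>2) = (\<Sum>m. (cmod (cheb_coef f m))\<^sup>2)"
proof -
  obtain g where g: "g \<in> L2c" "\<And>n. cheb_coef g n = cheb_coef f n"
    "(LINT x|mu_c. (cmod (g x))\<^sup>2) = (\<Sum>m. (cmod (cheb_coef f m))\<^sup>2)"
    using cheb_riesz_fischer[OF cheb_coef_sq_summable[OF f]] by blast
  note [measurable] = f g(1)
  have "AE x in mu_c. f x = g x"
    by (rule cheb_coef_eq_AE) (use f g in auto)
  then have "(LINT x|mu_c. (cmod (f x))\<^sup>2) = (LINT x|mu_c. (cmod (g x))\<^sup>2)"
    by (intro integral_cong_AE) (auto elim: eventually_mono)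
  with g show ?thesis by simp
qed

section \<open>The Wold decomposition of the tree shift\<close>

definition dft :: "nat \<Rightarrow> nat \<Rightarrow> nat \<Rightarrow> complex" where
  "dft N k i = cis (2 * pi * real k * real i / real N) / complex_of_real (sqrt (real N))"

lemma dft_0: "dft N 0 i = 1 / complex_of_real (sqrt (real N))"
  by (simp add: dft_def)

text \<open>A geometric sum over powers of an \<open>N\<close>-th root of unity; the bound on
  \<open>d\<close> makes 0 the only multiple of \<open>N\<close> available, so the root differs from
  1 otherwise.\<close>

lemma sum_cis_roots_unity:
  fixes d :: int
  assumes "\<bar>d\<bar> < int N"
  shows "(\<Sum>i<N. cis (2 * pi * of_int d * real i / real N)) = (if d = 0 then of_nat N else 0)"
proof (cases "d = 0")
  case False
  have N: "N > 0" using assms by auto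
  define z where "z = cis (2 * pi * of_int d / real N)"
  have "z \<noteq> 1"
  proof
    assume "z = 1"
    then have "cos (2 * pi * of_int d / real N) = 1" by (auto simp: z_def complex_eq_iff)
    then obtain n :: int where "2 * pi * of_int d / real N = of_int n * 2 * pi"
      by (auto simp: cos_one_2pi_int)
    then have "real_of_int d = of_int (n * int N)" using N by (simp add: field_simps)
    then have "d = n * int N" by linarith
    with assms False show False by (auto simp: abs_mult)
  qed
  have "z ^ N = cis (real N * (2 * pi * of_int d / real N))"
    by (simp only: z_def Complex.DeMoivre)
  also have "\<dots> = cis (2 * pi * of_int d)" using N by simp
  also have "\<dots> = 1" by (intro cis_multiple_2pi) simp
  finally have "z ^ N = 1" .
  have "(\<Sum>i<N. cis (2 * pi * of_int d * real i / real N)) = (\<Sum>i<N. z ^ i)"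
    by (intro sum.cong) (auto simp: z_def Complex.DeMoivre mult_ac)
  also have "\<dots> = 0"
    using \<open>z ^ N = 1\<close> \<open>z \<noteq> 1\<close> by (simp add: sum_gp_strict)
  finally show ?thesis using False by simp
qed simp

text \<open>All four indices are free, so this formula feeds orthogonality both over letters and
  over characters.\<close>

lemma cnj_dft_mult:
  assumes "N \<ge> 1"
  shows "cnj (dft N k i) * dft N l j
    = cis (2 * pi * (real l * real j - real k * real i) / real N) / of_nat N"
proof -
  have "complex_of_real (sqrt (real N)) * complex_of_real (sqrt (real N)) = of_nat N"
    by (simp flip: of_real_mult)
  then show ?thesis
    by (simp add: dft_def cis_cnj cis_mult diff_divide_distrib right_diff_distrib mult_ac)
qed

lemma dft_orthonormal_cols:
  assumes "N \<ge> 1" "k < N" "l < N"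
  shows "(\<Sum>i\<in>{1..N}. cnj (dft N k i) * dft N l i) = (if k = l then 1 else 0)"
proof -
  define d where "d = int l - int k"
  have "(\<Sum>i\<in>{1..N}. cnj (dft N k i) * dft N l i)
      = (\<Sum>i<N. cnj (dft N k (Suc i)) * dft N l (Suc i))"
    by (rule sum.reindex_bij_witness[of _ Suc "\<lambda>i. i - 1"]) auto
  \<comment> \<open>Letters start at 1, not 0; the offset contributes a constant phase, equal to 1
    when \<open>d = 0\<close> and otherwise multiplying a vanishing sum.\<close>
  also have "\<dots> = (\<Sum>i<N. cis (2 * pi * of_int d / real N) / of_nat N
      * cis (2 * pi * of_int d * real i / real N))"
    unfolding cnj_dft_mult[OF assms(1)]
    by (intro sum.cong) (auto simp: d_def cis_mult algebra_simps add_divide_distrib diff_divide_distrib)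
  also have "\<dots> = (if k = l then 1 else 0)"
    unfolding sum_distrib_left[symmetric]
    by (subst sum_cis_roots_unity) (use assms in \<open>auto simp: d_def\<close>)
  finally show ?thesis .
qed

lemma dft_orthonormal_rows:
  assumes "N \<ge> 1" "i \<in> {1..N}" "j \<in> {1..N}"
  shows "(\<Sum>k<N. cnj (dft N k i) * dft N k j) = (if i = j then 1 else 0)"
proof -
  define d where "d = int j - int i"
  have "(\<Sum>k<N. cnj (dft N k i) * dft N k j)
      = (\<Sum>k<N. 1 / of_nat N * cis (2 * pi * of_int d * real k / real N))"
    unfolding cnj_dft_mult[OF assms(1)] by (intro sum.cong) (auto simp: d_def algebra_simps)
  also have "\<dots> = (if i = j then 1 else 0)"
    unfolding sum_distrib_left[symmetric]
    by (subst sum_cis_roots_unity) (use assms in \<open>auto simp: d_def\<close>)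
  finally show ?thesis .
qed

section \<open>The backward shift and the characters on children\<close>

definition child_dft :: "nat \<Rightarrow> nat \<Rightarrow> (nat list \<Rightarrow> complex) \<Rightarrow> nat list \<Rightarrow> complex" where
  "child_dft N k g w = (\<Sum>i\<in>{1..N}. cnj (dft N k i) * g (w @ [i]))"

lemma child_dft_lincomb: "child_dft N k (\<lambda>w. a * f w + b * g w) = (\<lambda>w. a * child_dft N k f w + b * child_dft N k g w)"
  by (simp add: child_dft_def fun_eq_iff sum_distrib_left sum.distrib algebra_simps)

text \<open>The Fourier matrix acts unitarily on the \<open>N\<close> values at the children of
  \<open>w\<close>; expanding the squares reduces this to the row relations.\<close>

lemma child_dft_parseval:
  assumes "N \<ge> 1"
  shows "(\<Sum>k<N. (cmod (child_dft N k g w))\<^sup>2) = (\<Sum>i\<in>{1..N}. (cmod (g (w @ [i])))\<^sup>2)"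
proof -
  have "complex_of_real (\<Sum>k<N. (cmod (child_dft N k g w))\<^sup>2) = (\<Sum>k<N. child_dft N k g w * cnj (child_dft N k g w))"
    by (simp only: of_real_sum complex_norm_square)
  also have "\<dots> = (\<Sum>k<N. \<Sum>i\<in>{1..N}. \<Sum>j\<in>{1..N}.
      g (w @ [i]) * cnj (g (w @ [j])) * (cnj (dft N k i) * dft N k j))"
    unfolding child_dft_def cnj_sum sum_product by (intro sum.cong refl) (simp add: mult_ac)
  also have "\<dots> = (\<Sum>i\<in>{1..N}. \<Sum>j\<in>{1..N}. \<Sum>k<N.
      g (w @ [i]) * cnj (g (w @ [j])) * (cnj (dft N k i) * dft N k j))"
    by (subst sum.swap, rule sum.cong[OF refl], rule sum.swap)
  also have "\<dots> = (\<Sum>i\<in>{1..N}. \<Sum>j\<in>{1..N}.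
      if i = j then g (w @ [i]) * cnj (g (w @ [j])) else 0)"
    unfolding sum_distrib_left[symmetric]
    by (intro sum.cong refl) (use dft_orthonormal_rows[OF assms] in simp)
  also have "\<dots> = (\<Sum>i\<in>{1..N}. g (w @ [i]) * cnj (g (w @ [i])))"
    by (simp add: sum.delta')
  also have "\<dots> = complex_of_real (\<Sum>i\<in>{1..N}. (cmod (g (w @ [i])))\<^sup>2)"
    by (simp only: of_real_sum complex_norm_square)
  finally show ?thesis by (simp only: of_real_eq_iff)
qed

abbreviation vanishes_off_tree :: "nat \<Rightarrow> (nat list \<Rightarrow> complex) \<Rightarrow> bool" where
  "vanishes_off_tree N f \<equiv> \<forall>w. w \<notin> tree_V N \<longrightarrow> f w = 0"

lemma tree_V_Nil [simp]: "[] \<in> tree_V N"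
  and tree_V_snoc [simp]: "w @ [i] \<in> tree_V N \<longleftrightarrow> w \<in> tree_V N \<and> i \<in> {1..N}"
  by (auto simp: tree_V_def)

lemma child_dft_vanishes: "vanishes_off_tree N f \<Longrightarrow> vanishes_off_tree N (child_dft N k f)"
  by (simp add: child_dft_def)

text \<open>
  The index \<open>(w, k)\<close> with \<open>k \<noteq> 0\<close> is the \<open>k\<close>-th character on the children of \<open>w\<close>; the pair
  \<open>([], 0)\<close> encodes the root vector.  Since \<open>child_dft N 0\<close> is the adjoint of the isometry
  \<open>S / \<surd>N\<close>, \<open>tree_coef N f j m\<close> is the coefficient of \<open>f\<close> along the \<open>m\<close>-th shift of the \<open>j\<close>-th
  basis vector of \<open>ker S*\<close>.
\<close>

definition tree_coef :: "nat \<Rightarrow> (nat list \<Rightarrow> complex) \<Rightarrow> nat list \<times> nat \<Rightarrow> nat \<Rightarrow> complex" where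
  "tree_coef N f = (\<lambda>(w, k) m.
     if k = 0 then (child_dft N 0 ^^ m) f w else child_dft N k ((child_dft N 0 ^^ m) f) w)"

text \<open>The trivial character on the children of a word lies in the range of the shift, hence
  \<open>k\<close> starts at 1; the slot with \<open>k = 0\<close> is free to encode the root
  vector.\<close>

definition wandering_index :: "nat \<Rightarrow> (nat list \<times> nat) set" where
  "wandering_index N = insert ([], 0) (tree_V N \<times> {1..<N})"

lemma funpow_child_dft_lincomb:
  "(child_dft N k ^^ m) (\<lambda>w. a * f w + b * g w) = (\<lambda>w. a * (child_dft N k ^^ m) f w + b * (child_dft N k ^^ m) g w)"
  by (induction m) (simp_all add: child_dft_lincomb)

lemma tree_coef_lincomb:
  "tree_coef N (\<lambda>w. a * f w + b * g w) j m = a * tree_coef N f j m + b * tree_coef N g j m"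
  by (simp add: tree_coef_def funpow_child_dft_lincomb child_dft_lincomb split: prod.split)

lemma tree_coef_Suc: "tree_coef N f j (Suc m) = tree_coef N (child_dft N 0 f) j m"
  by (simp add: tree_coef_def funpow_swap1 split: prod.split)

section \<open>The forward shift and the Laplacian in Wold coordinates\<close>

definition up_shift :: "nat \<Rightarrow> (nat list \<Rightarrow> complex) \<Rightarrow> nat list \<Rightarrow> complex" where
  "up_shift N f w = (if w \<in> tree_V N \<and> w \<noteq> [] then f (butlast w) / complex_of_real (sqrt (real N)) else 0)"

definition root_delta :: "nat list \<Rightarrow> complex" where
  "root_delta w = (if w = [] then 1 else 0)"

lemma child_dft_root_delta: "child_dft N k root_delta = (\<lambda>_. 0)"
  by (simp add: child_dft_def root_delta_def fun_eq_iff)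

text \<open>\<open>up_shift\<close> is the isometry \<open>S / sqrt N\<close>. Its values agree on
  siblings, so only the trivial character sees them: \<open>k = 0\<close> says that the adjoint
  undoes the shift, \<open>k > 0\<close> that the other characters are orthogonal to its
  range.\<close>

lemma child_dft_up_shift:
  assumes "N \<ge> 1" "k < N" "vanishes_off_tree N f"
  shows "child_dft N k (up_shift N f) w = (if k = 0 then f w else 0)"
proof (cases "w \<in> tree_V N")
  case True
  have "child_dft N k (up_shift N f) w = (\<Sum>i\<in>{1..N}. f w * (cnj (dft N k i) * dft N 0 i))"
    using True by (auto simp: child_dft_def up_shift_def dft_0 intro!: sum.cong)
  also have "\<dots> = f w * (if k = 0 then 1 else 0)"
    unfolding sum_distrib_left[symmetric] using dft_orthonormal_cols[of N k 0] assms by simp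
  finally show ?thesis by simp
next
  case False
  then show ?thesis using assms by (simp add: child_dft_def up_shift_def)
qed

lemma tree_coef_up_shift:
  assumes "N \<ge> 1" "vanishes_off_tree N f" "j \<in> wandering_index N"
  shows "tree_coef N (up_shift N f) j m = (if m = 0 then 0 else tree_coef N f j (m - 1))"
proof (cases m)
  case 0
  with assms show ?thesis
    by (auto simp: wandering_index_def tree_coef_def child_dft_up_shift) (simp add: up_shift_def)
next
  case (Suc m')
  have "child_dft N 0 (up_shift N f) = f" using assms by (simp add: child_dft_up_shift fun_eq_iff)
  with Suc show ?thesis by (simp add: tree_coef_Suc)
qed

lemma tree_coef_zero: "tree_coef N (\<lambda>_. 0) j m = 0"
  using tree_coef_lincomb[of N 0 "\<lambda>_. 0" 0 "\<lambda>_. 0" j m] by simp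

text \<open>Every \<open>child_dft\<close> annihilates the root vector, which is thus the basis
  vector of index \<open>([], 0)\<close> and nothing else.\<close>

lemma tree_coef_root_delta:
  assumes "j \<in> wandering_index N"
  shows "tree_coef N root_delta j m = (if j = ([], 0) \<and> m = 0 then 1 else 0)"
proof (cases m)
  case 0
  with assms show ?thesis
    by (auto simp: wandering_index_def tree_coef_def child_dft_root_delta) (simp add: root_delta_def)
next
  case (Suc m')
  then show ?thesis by (simp add: tree_coef_Suc child_dft_root_delta tree_coef_zero)
qed

text \<open>A vertex other than the root has degree \<open>N + 1\<close>, the root only
  \<open>N\<close>; the last term corrects the diagonal there.\<close>

lemma tree_lap_decomp:
  assumes "N \<ge> 1" "vanishes_off_tree N f"
  shows "tree_lap N f w = of_nat (N + 1) * f w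
    - complex_of_real (sqrt (real N)) * (up_shift N f w + child_dft N 0 f w) - f [] * root_delta w"
proof (cases "w \<in> tree_V N")
  case True
  have s: "complex_of_real (sqrt (real N)) \<noteq> 0" using assms by simp
  have "complex_of_real (sqrt (real N)) * child_dft N 0 f w = (\<Sum>i\<in>{1..N}. f (w @ [i]))"
    using s by (simp add: child_dft_def dft_0 sum_distrib_left)
  with True s show ?thesis
    by (auto simp: tree_lap_def up_shift_def root_delta_def sum_subtractf algebra_simps)
next
  case False
  then show ?thesis
    using assms child_dft_vanishes[OF assms(2), of 0]
    by (auto simp: tree_lap_def up_shift_def root_delta_def)
qed

text \<open>On each chain of shifts the Laplacian is a Jacobi matrix, and the rank-one correction is
  felt only at the start of the root chain. \<open>T_model_L2c_coef\<close> has the same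
  form.\<close>

lemma tree_coef_tree_lap:
  assumes "N \<ge> 1" "vanishes_off_tree N f" "j \<in> wandering_index N"
  shows "tree_coef N (tree_lap N f) j m = of_nat (N + 1) * tree_coef N f j m
    - complex_of_real (sqrt (real N))
      * (tree_coef N f j (Suc m) + (if m = 0 then 0 else tree_coef N f j (m - 1)))
    - (if j = ([], 0) \<and> m = 0 then tree_coef N f j 0 else 0)"
proof -
  let ?s = "complex_of_real (sqrt (real N))"
  \<comment> \<open>The factors 1 and the nesting bring the decomposition into the binary shape of
    \<open>tree_coef_lincomb\<close>.\<close>
  have "tree_lap N f = (\<lambda>w. 1 * (of_nat (N + 1) * f w + (- ?s) * (1 * up_shift N f w + 1 * child_dft N 0 f w))
      + (- f []) * root_delta w)"
    using tree_lap_decomp[OF assms(1,2)] by (simp add: fun_eq_iff)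
  then have "tree_coef N (tree_lap N f) j m = of_nat (N + 1) * tree_coef N f j m
      - ?s * (tree_coef N (up_shift N f) j m + tree_coef N (child_dft N 0 f) j m)
      - f [] * tree_coef N root_delta j m"
    by (simp only: tree_coef_lincomb) simp
  moreover have "tree_coef N f ([], 0) 0 = f []" by (simp add: tree_coef_def)
  ultimately show ?thesis
    using assms by (simp add: tree_coef_up_shift tree_coef_root_delta tree_coef_Suc add.commute)
qed

text \<open>
  Letters are read from the end of the word: \<open>tree_synth N b m (rev w)\<close> is the value at \<open>w\<close> of the
  \<open>m\<close>-fold backward shift of the function with coefficients \<open>b\<close>, obtained by inverting the
  discrete Fourier transform on the children of each word.
\<close>

fun tree_synth :: "nat \<Rightarrow> (nat list \<times> nat \<Rightarrow> nat \<Rightarrow> complex) \<Rightarrow> nat \<Rightarrow> nat list \<Rightarrow> complex" where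
  "tree_synth N b m [] = b ([], 0) m"
| "tree_synth N b m (i # u) = dft N 0 i * tree_synth N b (Suc m) u
     + (\<Sum>k\<in>{1..<N}. dft N k i * b (rev u, k) m)"

text \<open>The Fourier transform on children is inverted level by level for arbitrary
  \<open>b\<close>; square-summability of the result is settled later by
  \<open>tree_parseval\<close>.\<close>

lemma tree_coef_surj:
  assumes "N \<ge> 1"
  obtains f where "vanishes_off_tree N f"
    "\<And>j m. j \<in> wandering_index N \<Longrightarrow> tree_coef N f j m = b j m"
proof -
  define G where "G m w = (if w \<in> tree_V N then tree_synth N b m (rev w) else 0)" for m w
  have dftG: "child_dft N k (G m) w = (if k = 0 then G (Suc m) w else b (w, k) m)"
    if "k < N" "w \<in> tree_V N" for k m w
  proof -
    define c where "c l = (if l = 0 then G (Suc m) w else b (w, l) m)" for l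
    have "G m (w @ [i]) = (\<Sum>l<N. dft N l i * c l)" if i: "i \<in> {1..N}" for i
    proof -
      have "{..<N} = insert 0 {1..<N}" using assms by auto
      then show ?thesis using i \<open>w \<in> tree_V N\<close> by (auto simp: G_def c_def intro!: sum.cong)
    qed
    then have "child_dft N k (G m) w = (\<Sum>i\<in>{1..N}. \<Sum>l<N. c l * (cnj (dft N k i) * dft N l i))"
      by (simp add: child_dft_def sum_distrib_left mult_ac)
    also have "\<dots> = (\<Sum>l<N. c l * (\<Sum>i\<in>{1..N}. cnj (dft N k i) * dft N l i))"
      by (subst sum.swap) (simp add: sum_distrib_left)
    also have "\<dots> = (\<Sum>l<N. if k = l then c l else 0)"
      using dft_orthonormal_cols[OF assms \<open>k < N\<close>] by (intro sum.cong) auto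
    also have "\<dots> = c k" using that by simp
    finally show ?thesis by (simp add: c_def)
  qed
  have van: "vanishes_off_tree N (G m)" for m by (simp add: G_def)
  have "child_dft N 0 (G m) = G (Suc m)" for m
  proof
    fix w show "child_dft N 0 (G m) w = G (Suc m) w"
      using dftG[of 0 w m] child_dft_vanishes[OF van[of m], of 0] van[of "Suc m"] assms
      by (cases "w \<in> tree_V N") auto
  qed
  then have pow: "(child_dft N 0 ^^ m) (G 0) = G m" for m by (induction m) auto
  have "tree_coef N (G 0) j m = b j m" if "j \<in> wandering_index N" for j m
    using that dftG by (auto simp: wandering_index_def tree_coef_def pow) (simp add: G_def)
  with van show ?thesis using that by blast
qed

text \<open>
  Parseval's identity on the tree is exact on each ball: the words of length less than \<open>L\<close> correspond to
  the finitely many coefficients supported there, \<open>coef_level j + m\<close> being the length of the words that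
  carry the \<open>m\<close>-th shift of the \<open>j\<close>-th basis vector.
\<close>

definition ball_V :: "nat \<Rightarrow> nat \<Rightarrow> nat list set" where
  "ball_V N L = {w \<in> tree_V N. length w < L}"

definition coef_level :: "nat list \<times> nat \<Rightarrow> nat" where
  "coef_level = (\<lambda>(w, k). if k = 0 then 0 else Suc (length w))"

definition coef_ball :: "nat \<Rightarrow> nat \<Rightarrow> ((nat list \<times> nat) \<times> nat) set" where
  "coef_ball N L = {(j, m). j \<in> wandering_index N \<and> coef_level j + m < L}"

lemma ball_V_Suc: "ball_V N (Suc L) = insert [] ((\<lambda>(w, i). w @ [i]) ` (ball_V N L \<times> {1..N}))"
proof (intro set_eqI)
  fix x show "x \<in> ball_V N (Suc L) \<longleftrightarrow> x \<in> insert [] ((\<lambda>(w, i). w @ [i]) ` (ball_V N L \<times> {1..N}))"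
    by (cases x rule: rev_cases) (auto simp: ball_V_def image_iff)
qed

lemma finite_ball_V: "finite (ball_V N L)"
  by (induction L) (auto simp: ball_V_Suc, simp add: ball_V_def)

text \<open>Positive \<open>m\<close> comes from the smaller ball by one shift; \<open>m = 0\<close>
  leaves the root vector and the characters on children of words in the smaller ball.\<close>

lemma coef_ball_Suc: "coef_ball N (Suc L) = (\<lambda>(j, m). (j, Suc m)) ` coef_ball N L
    \<union> (\<lambda>j. (j, 0)) ` insert ([], 0) (ball_V N L \<times> {1..<N})"
proof (intro set_eqI)
  fix x :: "(nat list \<times> nat) \<times> nat"
  obtain w k m where x: "x = ((w, k), m)" by (metis surj_pair)
  show "x \<in> coef_ball N (Suc L) \<longleftrightarrow> x \<in> (\<lambda>(j, m). (j, Suc m)) ` coef_ball N L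
    \<union> (\<lambda>j. (j, 0)) ` insert ([], 0) (ball_V N L \<times> {1..<N})"
    unfolding x by (cases m) (auto simp: coef_ball_def wandering_index_def coef_level_def ball_V_def image_iff)
qed

lemma finite_coef_ball: "finite (coef_ball N L)"
  by (induction L) (auto simp: coef_ball_Suc finite_ball_V, simp add: coef_ball_def)

text \<open>Words other than the root are grouped by parent and transformed unitarily. The trivial
  characters give the same sum for \<open>child_dft N 0 f\<close> on the smaller ball, which is why
  \<open>f\<close> varies in the induction.\<close>

lemma sum_ball_V_eq_sum_coef_ball:
  assumes "N \<ge> 1"
  shows "(\<Sum>w\<in>ball_V N L. (cmod (f w))\<^sup>2) = (\<Sum>(j, m)\<in>coef_ball N L. (cmod (tree_coef N f j m))\<^sup>2)"
proof (induction L arbitrary: f)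
  case 0
  then show ?case by (simp add: ball_V_def coef_ball_def)
next
  case (Suc L)
  let ?t = "\<lambda>f (j, m). (cmod (tree_coef N f j m))\<^sup>2"
  have split: "{..<N} = insert 0 {1..<N}" using assms by auto
  have "(\<Sum>w\<in>ball_V N (Suc L). (cmod (f w))\<^sup>2)
      = (cmod (f []))\<^sup>2 + (\<Sum>w\<in>(\<lambda>(w, i). w @ [i]) ` (ball_V N L \<times> {1..N}). (cmod (f w))\<^sup>2)"
    unfolding ball_V_Suc by (subst sum.insert) (auto simp: finite_ball_V)
  also have "(\<Sum>w\<in>(\<lambda>(w, i). w @ [i]) ` (ball_V N L \<times> {1..N}). (cmod (f w))\<^sup>2)
      = (\<Sum>w\<in>ball_V N L. \<Sum>i\<in>{1..N}. (cmod (f (w @ [i])))\<^sup>2)"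
    by (subst sum.reindex) (auto simp: inj_on_def sum.cartesian_product intro!: sum.cong)
  also have "\<dots> = (\<Sum>w\<in>ball_V N L. (cmod (child_dft N 0 f w))\<^sup>2) + (\<Sum>w\<in>ball_V N L. \<Sum>k\<in>{1..<N}. (cmod (child_dft N k f w))\<^sup>2)"
    unfolding child_dft_parseval[OF assms, symmetric] split by (simp add: sum.distrib)
  also have "(\<Sum>w\<in>ball_V N L. (cmod (child_dft N 0 f w))\<^sup>2) = sum (?t (child_dft N 0 f)) (coef_ball N L)"
    by (rule Suc)
  also have "\<dots> = sum (?t f) ((\<lambda>(j, m). (j, Suc m)) ` coef_ball N L)"
    by (subst sum.reindex) (auto simp: inj_on_def tree_coef_Suc intro!: sum.cong)
  finally have "(\<Sum>w\<in>ball_V N (Suc L). (cmod (f w))\<^sup>2)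
      = sum (?t f) ((\<lambda>(j, m). (j, Suc m)) ` coef_ball N L)
        + ((cmod (f []))\<^sup>2 + (\<Sum>w\<in>ball_V N L. \<Sum>k\<in>{1..<N}. (cmod (child_dft N k f w))\<^sup>2))"
    by simp
  also have "(\<Sum>w\<in>ball_V N L. \<Sum>k\<in>{1..<N}. (cmod (child_dft N k f w))\<^sup>2)
      = (\<Sum>j\<in>ball_V N L \<times> {1..<N}. ?t f (j, 0))"
    by (auto simp: sum.cartesian_product tree_coef_def intro!: sum.cong)
  also have "(cmod (f []))\<^sup>2 + \<dots> = (\<Sum>j\<in>insert ([], 0) (ball_V N L \<times> {1..<N}). ?t f (j, 0))"
    by (subst sum.insert) (auto simp: finite_ball_V tree_coef_def)
  also have "\<dots> = sum (?t f) ((\<lambda>j. (j, 0)) ` insert ([], 0) (ball_V N L \<times> {1..<N}))"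
    by (subst sum.reindex) (auto simp: inj_on_def)
  also have "sum (?t f) ((\<lambda>(j, m). (j, Suc m)) ` coef_ball N L) + \<dots> = sum (?t f) (coef_ball N (Suc L))"
    unfolding coef_ball_Suc
    by (subst sum.union_disjoint) (auto simp: finite_coef_ball finite_ball_V)
  finally show ?case .
qed

text \<open>For nonnegative terms, the unordered sum is the limit along any increasing exhaustion by
  finite sets.\<close>

lemma has_sum_exhaustion:
  fixes f :: "'a \<Rightarrow> real"
  assumes nonneg: "\<And>x. f x \<ge> 0" and fin: "\<And>L. finite (B L)" and inc: "incseq B" and un: "(\<Union>L. B L) = A"
  shows "(f has_sum s) A \<longleftrightarrow> (\<lambda>L. sum f (B L)) \<longlonglongrightarrow> s"
proof -
  have absorb: "\<exists>L. F \<subseteq> B L" if "finite F" "F \<subseteq> A" for F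
    using that
  proof (induction F)
    case (insert x F)
    then obtain K L where "F \<subseteq> B L" "x \<in> B K" using un by auto
    then have "insert x F \<subseteq> B (max K L)"
      using incseqD[OF inc, of K "max K L"] incseqD[OF inc, of L "max K L"] by auto
    then show ?case by blast
  qed simp
  \<comment> \<open>The sets \<open>B L\<close> eventually contain each finite subset of
    \<open>A\<close>, so they run through the filter that defines \<open>has_sum\<close>.\<close>
  have fil: "filterlim B (finite_subsets_at_top A) sequentially"
    unfolding filterlim_finite_subsets_at_top
  proof (intro allI impI)
    fix F assume "finite F \<and> F \<subseteq> A"
    then obtain L where L: "F \<subseteq> B L" using absorb by blast
    show "\<forall>\<^sub>F L in sequentially. finite (B L) \<and> F \<subseteq> B L \<and> B L \<subseteq> A"
      using eventually_ge_at_top[of L]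
      by eventually_elim (use L fin un incseqD[OF inc] in blast)
  qed
  have fwd: "(\<lambda>L. sum f (B L)) \<longlonglongrightarrow> t" if "(f has_sum t) A" for t
    using that fil unfolding has_sum_def by (rule filterlim_compose)
  show ?thesis
  proof
    assume lim: "(\<lambda>L. sum f (B L)) \<longlonglongrightarrow> s"
    \<comment> \<open>Monotonicity makes \<open>s\<close> an upper bound for all finite sums, hence
      summability; the forward direction then fixes the value.\<close>
    have mono: "incseq (\<lambda>L. sum f (B L))"
      using inc by (auto simp: incseq_def intro!: sum_mono2 fin nonneg)
    have "sum f F \<le> s" if F: "finite F" "F \<subseteq> A" for F
    proof -
      obtain L where "F \<subseteq> B L" using absorb[OF F] by blast
      then have "sum f F \<le> sum f (B L)" by (rule sum_mono2[OF fin _ nonneg])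
      also have "\<dots> \<le> s" using incseq_le[OF mono lim] .
      finally show ?thesis .
    qed
    then have "f summable_on A"
      by (intro nonneg_bdd_above_summable_on nonneg bdd_aboveI2[where M = s]) blast
    then have sums: "(f has_sum infsum f A) A" by simp
    with LIMSEQ_unique[OF fwd[OF sums] lim] show "(f has_sum s) A" by simp
  qed (rule fwd)
qed

text \<open>The finite identities pass to the limit along both exhaustions. Stated for every
  \<open>s\<close>, the equivalence carries summability in either direction.\<close>

lemma tree_parseval:
  assumes "N \<ge> 1"
  shows "((\<lambda>w. (cmod (f w))\<^sup>2) has_sum s) (tree_V N)
    \<longleftrightarrow> ((\<lambda>(j, m). (cmod (tree_coef N f j m))\<^sup>2) has_sum s) (wandering_index N \<times> UNIV)"
proof -
  have "((\<lambda>w. (cmod (f w))\<^sup>2) has_sum s) (tree_V N)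
      \<longleftrightarrow> (\<lambda>L. \<Sum>w\<in>ball_V N L. (cmod (f w))\<^sup>2) \<longlonglongrightarrow> s"
    by (rule has_sum_exhaustion) (auto simp: finite_ball_V, auto simp: ball_V_def incseq_def)
  also have "\<dots> \<longleftrightarrow> ((\<lambda>(j, m). (cmod (tree_coef N f j m))\<^sup>2) has_sum s) (wandering_index N \<times> UNIV)"
    unfolding sum_ball_V_eq_sum_coef_ball[OF assms]
    by (rule has_sum_exhaustion[symmetric])
       (auto simp: finite_coef_ball, auto simp: coef_ball_def incseq_def)
  finally show ?thesis .
qed

section \<open>The unitary equivalence\<close>

text \<open>The coefficients determine a function only up to null sets, so a representative is
  chosen; linearity of the resulting map can hold only almost everywhere.\<close>

definition cheb_synth :: "(nat \<Rightarrow> complex) \<Rightarrow> real \<Rightarrow> complex" where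
  "cheb_synth a = (SOME f. f \<in> L2c \<and> (\<forall>n. cheb_coef f n = a n))"

lemma
  assumes "summable (\<lambda>m. (cmod (a m))\<^sup>2)"
  shows cheb_synth_L2c: "cheb_synth a \<in> L2c"
    and cheb_coef_cheb_synth: "cheb_coef (cheb_synth a) n = a n"
proof -
  have "\<exists>f. f \<in> L2c \<and> (\<forall>n. cheb_coef f n = a n)"
    using cheb_riesz_fischer[OF assms] by metis
  then have "cheb_synth a \<in> L2c \<and> (\<forall>n. cheb_coef (cheb_synth a) n = a n)"
    unfolding cheb_synth_def by (rule someI_ex)
  then show "cheb_synth a \<in> L2c" "cheb_coef (cheb_synth a) n = a n" by auto
qed

lemma has_sum_cheb_coef:
  assumes "f \<in> L2c"
  shows "((\<lambda>m. (cmod (cheb_coef f m))\<^sup>2) has_sum (LINT x|mu_c. (cmod (f x))\<^sup>2)) UNIV"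
  unfolding cheb_parseval[OF assms]
  by (intro sums_nonneg_imp_has_sum summable_sums cheb_coef_sq_summable assms) auto

text \<open>Parseval in each summand, combined with the interchange of iterated and double sums of
  nonnegative terms.\<close>

lemma dsum_norm_sq_has_sum_iff:
  assumes g: "\<And>n. n \<in> I \<Longrightarrow> g n \<in> L2c"
  shows "((\<lambda>n. LINT x|mu_c. (cmod (g n x))\<^sup>2) has_sum s) I
      \<longleftrightarrow> ((\<lambda>(n, m). (cmod (cheb_coef (g n) m))\<^sup>2) has_sum s) (I \<times> UNIV)"
proof
  let ?c = "\<lambda>(n, m). (cmod (cheb_coef (g n) m))\<^sup>2"
  have inner: "((\<lambda>m. ?c (n, m)) has_sum (LINT x|mu_c. (cmod (g n x))\<^sup>2)) UNIV" if "n \<in> I" for n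
    using has_sum_cheb_coef[OF g[OF that]] by simp
  {
    assume *: "((\<lambda>n. LINT x|mu_c. (cmod (g n x))\<^sup>2) has_sum s) I"
    show "(?c has_sum s) (I \<times> UNIV)"
      by (rule has_sum_SigmaI[OF inner *], assumption,
          rule summable_on_SigmaI[OF inner has_sum_imp_summable[OF *]]) auto
  next
    assume "(?c has_sum s) (I \<times> UNIV)"
    then show "((\<lambda>n. LINT x|mu_c. (cmod (g n x))\<^sup>2) has_sum s) I"
      by (rule has_sum_SigmaD) (rule inner)
  }
qed

lemma T_model_L2c_coef:
  assumes "g n \<in> L2c"
  shows "T_model N g n \<in> L2c"
    and "cheb_coef (T_model N g n) m = of_nat (N + 1) * cheb_coef (g n) m
      - complex_of_real (sqrt (real N))
        * (cheb_coef (g n) (Suc m) + (if m = 0 then 0 else cheb_coef (g n) (m - 1)))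
      - (if n = 0 \<and> m = 0 then cheb_coef (g n) 0 else 0)"
proof -
  let ?s = "complex_of_real (2 * sqrt (real N))"
  let ?h = "\<lambda>x. of_nat (N + 1) * g n x + (- ?s) * Mx (g n) x"
  let ?e = "if n = 0 then cheb_coef (g n) 0 else 0"
  have h: "?h \<in> L2c" using assms by (intro L2c_lincomb Mx_L2c)
  \<comment> \<open>The expectation \<open>Ec\<close> is the zeroth coefficient since
    \<open>chebU 0\<close> is 1; subtracting it as a constant function changes the zeroth
    coefficient only.\<close>
  have T: "T_model N g n = (\<lambda>x. 1 * ?h x + (- 1) * ?e)"
    by (auto simp: T_model_def A_Delta_def Ec_def cheb_coef_def fun_eq_iff)
  show "T_model N g n \<in> L2c"
    unfolding T by (rule L2c_lincomb[OF h L2c_const])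
  have "cheb_coef (T_model N g n) m = 1 * cheb_coef ?h m + (- 1) * cheb_coef (\<lambda>_. ?e) m"
    unfolding T by (rule cheb_coef_lincomb[OF h L2c_const])
  also have "cheb_coef ?h m = of_nat (N + 1) * cheb_coef (g n) m + (- ?s) * cheb_coef (Mx (g n)) m"
    by (intro cheb_coef_lincomb Mx_L2c assms)
  finally show "cheb_coef (T_model N g n) m = of_nat (N + 1) * cheb_coef (g n) m
      - complex_of_real (sqrt (real N))
        * (cheb_coef (g n) (Suc m) + (if m = 0 then 0 else cheb_coef (g n) (m - 1)))
      - (if n = 0 \<and> m = 0 then cheb_coef (g n) 0 else 0)"
    by (simp only: cheb_coef_Mx[OF assms] cheb_coef_const) simp
qed

lemma l2V_lincomb:
  assumes "f \<in> l2V N" "g \<in> l2V N"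
  shows "(\<lambda>w. a * f w + b * g w) \<in> l2V N"
proof -
  have "(\<lambda>w. (cmod (a * f w + b * g w))\<^sup>2) summable_on tree_V N"
  proof (rule summable_on_comparison_test)
    show "(\<lambda>w. 2 * (cmod a)\<^sup>2 * (cmod (f w))\<^sup>2 + 2 * (cmod b)\<^sup>2 * (cmod (g w))\<^sup>2) summable_on tree_V N"
      using assms by (intro summable_on_add summable_on_cmult_right) (auto simp: l2V_def)
    fix w
    show "(cmod (a * f w + b * g w))\<^sup>2 \<le> 2 * (cmod a)\<^sup>2 * (cmod (f w))\<^sup>2 + 2 * (cmod b)\<^sup>2 * (cmod (g w))\<^sup>2"
      by (rule cmod_lincomb_sq_le)
  qed auto
  with assms show ?thesis by (simp add: l2V_def)
qed

text \<open>The unitary carries the coefficients of \<open>f\<close> along the chain of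
  \<open>\<beta> n\<close> to the Chebyshev coefficients of the \<open>n\<close>-th summand. Both
  sides of each claim are compared through these coefficients.\<close>

lemma unit_equiv_of_wandering_index_enum:
  assumes N: "N \<ge> 1" and bij: "bij_betw \<beta> I (wandering_index N)" and 0: "0 \<in> I" "\<beta> 0 = ([], 0)"
  shows "unit_equiv N (tree_lap N) I (T_model N)"
proof -
  define U where "U f n = (if n \<in> I then cheb_synth (tree_coef N f (\<beta> n)) else (\<lambda>_. 0))" for f n
  have \<beta>: "\<beta> n \<in> wandering_index N" if "n \<in> I" for n
    using bij that by (auto simp: bij_betw_def)
  \<comment> \<open>This matches the rank-one terms: the model has its own at \<open>n = 0\<close>,
    the tree at \<open>([], 0)\<close>.\<close>
  have \<beta>0: "\<beta> n = ([], 0) \<longleftrightarrow> n = 0" if "n \<in> I" for n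
    using bij that 0 by (auto simp: bij_betw_def inj_on_def)
  have parseval: "((\<lambda>w. (cmod (f w))\<^sup>2) has_sum s) (tree_V N)
      \<longleftrightarrow> ((\<lambda>(n, m). (cmod (tree_coef N f (\<beta> n) m))\<^sup>2) has_sum s) (I \<times> UNIV)" for f s
    using tree_parseval[OF N, of f s]
      has_sum_reindex_bij_betw[OF bij_betw_map_prod[OF bij bij_betw_id[of "UNIV :: nat set"]],
        of "\<lambda>(j, m). (cmod (tree_coef N f j m))\<^sup>2" s]
    by (simp add: case_prod_unfold)
  have coef_summable: "summable (\<lambda>m. (cmod (tree_coef N f (\<beta> n) m))\<^sup>2)"
    if f: "f \<in> l2V N" and n: "n \<in> I" for f n
  proof -
    have "((\<lambda>w. (cmod (f w))\<^sup>2) has_sum (\<Sum>\<^sub>\<infinity>w\<in>tree_V N. (cmod (f w))\<^sup>2)) (tree_V N)"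
      using f by (simp add: l2V_def)
    then have "(\<lambda>(n, m). (cmod (tree_coef N f (\<beta> n) m))\<^sup>2) summable_on I \<times> UNIV"
      unfolding parseval by (rule has_sum_imp_summable)
    \<comment> \<open>Restrict the double family to its \<open>n\<close>-th row.\<close>
    then have "(\<lambda>(n, m). (cmod (tree_coef N f (\<beta> n) m))\<^sup>2) summable_on Pair n ` UNIV"
      by (rule summable_on_subset_banach) (use n in auto)
    then show ?thesis
      by (subst (asm) summable_on_reindex) (auto simp: inj_on_def o_def intro: summable_on_imp_summable)
  qed
  have U_L2c: "U f n \<in> L2c" and U_coef: "cheb_coef (U f n) m = tree_coef N f (\<beta> n) m"
    if "f \<in> l2V N" "n \<in> I" for f n m
    using cheb_synth_L2c[OF coef_summable[OF that]] cheb_coef_cheb_synth[OF coef_summable[OF that]] that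
    by (simp_all add: U_def)
  have U_norm: "((\<lambda>n. LINT x|mu_c. (cmod (U f n x))\<^sup>2) has_sum (\<Sum>\<^sub>\<infinity>w\<in>tree_V N. (cmod (f w))\<^sup>2)) I"
    if f: "f \<in> l2V N" for f
  proof -
    have "((\<lambda>w. (cmod (f w))\<^sup>2) has_sum (\<Sum>\<^sub>\<infinity>w\<in>tree_V N. (cmod (f w))\<^sup>2)) (tree_V N)"
      using f by (simp add: l2V_def)
    then have "((\<lambda>(n, m). (cmod (cheb_coef (U f n) m))\<^sup>2)
        has_sum (\<Sum>\<^sub>\<infinity>w\<in>tree_V N. (cmod (f w))\<^sup>2)) (I \<times> UNIV)"
      unfolding parseval by (rule has_sum_cong[THEN iffD1, rotated]) (auto simp: U_coef f)
    then show ?thesis using dsum_norm_sq_has_sum_iff[of I "U f"] U_L2c[OF f] by simp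
  qed
  show ?thesis
    unfolding unit_equiv_def
  proof (intro exI[of _ U] conjI ballI allI)
    fix f assume f: "f \<in> l2V N"
    show "U f \<in> dsum I"
      using U_L2c[OF f] has_sum_imp_summable[OF U_norm[OF f]] by (auto simp: dsum_def U_def)
    show "dsum_norm I (U f) = l2V_norm N f"
      using infsumI[OF U_norm[OF f]] by (simp add: dsum_norm_def l2V_norm_def)
    show "dsum_eq I (U (tree_lap N f)) (T_model N (U f))"
      unfolding dsum_eq_def
    proof
      fix n assume n: "n \<in> I"
      have van: "vanishes_off_tree N f" using f by (simp add: l2V_def)
      have eq: "cheb_coef (T_model N (U f) n) m = tree_coef N (tree_lap N f) (\<beta> n) m" for m
        by (simp only: T_model_L2c_coef(2)[of "U f" n N m, OF U_L2c[OF f n]]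
          tree_coef_tree_lap[OF N van \<beta>[OF n], of m] U_coef[OF f n] \<beta>0[OF n])
      have T: "T_model N (U f) n \<in> L2c" by (intro T_model_L2c_coef U_L2c f n)
      \<comment> \<open>Square-summability for \<open>tree_lap N f\<close> is read off from the
        model side, where \<open>T_model N (U f) n\<close> is already known to be in
        \<open>L2c\<close>.\<close>
      have sm: "summable (\<lambda>m. (cmod (tree_coef N (tree_lap N f) (\<beta> n) m))\<^sup>2)"
        using cheb_coef_sq_summable[OF T] by (simp add: eq)
      have "U (tree_lap N f) n = cheb_synth (tree_coef N (tree_lap N f) (\<beta> n))"
        using n by (simp add: U_def)
      then show "AE x in mu_c. U (tree_lap N f) n x = T_model N (U f) n x"
        using T cheb_synth_L2c[OF sm] cheb_coef_cheb_synth[OF sm] eq by (intro cheb_coef_eq_AE) auto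
    qed
  next
    fix f g and a b :: complex assume fg: "f \<in> l2V N" "g \<in> l2V N"
    show "dsum_eq I (U (\<lambda>w. a * f w + b * g w)) (\<lambda>n x. a * U f n x + b * U g n x)"
      unfolding dsum_eq_def
    proof
      fix n assume n: "n \<in> I"
      show "AE x in mu_c. U (\<lambda>w. a * f w + b * g w) n x = a * U f n x + b * U g n x"
        using fg n
        by (intro cheb_coef_eq_AE U_L2c l2V_lincomb L2c_lincomb)
           (simp_all add: U_coef l2V_lincomb cheb_coef_lincomb U_L2c tree_coef_lincomb)
    qed
  next
    fix h assume h: "h \<in> dsum I"
    then have h_L2c: "h n \<in> L2c" if "n \<in> I" for n using that by (simp add: dsum_def)
    obtain f where f: "vanishes_off_tree N f" "\<And>j m. j \<in> wandering_index N \<Longrightarrow>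
        tree_coef N f j m = cheb_coef (h (inv_into I \<beta> j)) m"
      using tree_coef_surj[OF N, where b = "\<lambda>j. cheb_coef (h (inv_into I \<beta> j))"] by blast
    have coef: "tree_coef N f (\<beta> n) m = cheb_coef (h n) m" if "n \<in> I" for n m
      using f(2)[OF \<beta>[OF that]] bij that by (simp add: bij_betw_inv_into_left)
    have "((\<lambda>n. LINT x|mu_c. (cmod (h n x))\<^sup>2) has_sum (\<Sum>\<^sub>\<infinity>n\<in>I. LINT x|mu_c. (cmod (h n x))\<^sup>2)) I"
      using h by (simp add: dsum_def)
    then have "((\<lambda>(n, m). (cmod (cheb_coef (h n) m))\<^sup>2)
        has_sum (\<Sum>\<^sub>\<infinity>n\<in>I. LINT x|mu_c. (cmod (h n x))\<^sup>2)) (I \<times> UNIV)"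
      using dsum_norm_sq_has_sum_iff[of I h] h_L2c by simp
    then have "((\<lambda>(n, m). (cmod (tree_coef N f (\<beta> n) m))\<^sup>2)
        has_sum (\<Sum>\<^sub>\<infinity>n\<in>I. LINT x|mu_c. (cmod (h n x))\<^sup>2)) (I \<times> UNIV)"
      by (rule has_sum_cong[THEN iffD1, rotated]) (auto simp: coef)
    \<comment> \<open>Parseval read backwards: the summable coefficients of \<open>h\<close> force
      the synthesized \<open>f\<close> into \<open>l2V N\<close>.\<close>
    then have fl: "f \<in> l2V N"
      using f(1) unfolding parseval[symmetric] l2V_def by (auto dest: has_sum_imp_summable)
    have "dsum_eq I (U f) h"
      unfolding dsum_eq_def
      by (intro ballI cheb_coef_eq_AE U_L2c fl h_L2c) (simp_all add: U_coef fl coef)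
    with fl show "\<exists>f\<in>l2V N. dsum_eq I (U f) h" by blast
  qed
qed

text \<open>The nontrivial characters form a countably infinite set, enumerated after the root
  vector.\<close>

lemma wandering_index_enum:
  assumes "N \<ge> 2"
  obtains \<beta> :: "nat \<Rightarrow> nat list \<times> nat"
  where "bij_betw \<beta> UNIV (wandering_index N)" "\<beta> 0 = ([], 0)"
proof -
  let ?X = "tree_V N \<times> {1..<N}"
  \<comment> \<open>For \<open>N \<ge> 2\<close> the character 1 is nontrivial, and the words with
    all letters 1 already supply infinitely many indices.\<close>
  have "inj (\<lambda>n. (replicate n (1::nat), 1::nat))"
    by (rule injI) (metis length_replicate fst_conv)
  moreover have "range (\<lambda>n. (replicate n (1::nat), 1::nat)) \<subseteq> ?X"
    using assms by (auto simp: tree_V_def)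
  ultimately have inf: "infinite ?X"
    using finite_subset range_inj_infinite by blast
  have bij: "bij_betw (from_nat_into ?X) UNIV ?X"
    by (rule bij_betw_from_nat_into) (use inf in auto)
  define \<beta> where "\<beta> n = (case n of 0 \<Rightarrow> ([], 0) | Suc m \<Rightarrow> from_nat_into ?X m)" for n
  have "bij_betw \<beta> UNIV (wandering_index N)"
    unfolding bij_betw_def
  proof
    have ne: "from_nat_into ?X m \<in> ?X" for m using bij by (auto simp: bij_betw_def)
    show "inj \<beta>"
    proof (rule injI)
      fix m n assume "\<beta> m = \<beta> n"
      then show "m = n"
        using bij ne[of "m - 1"] ne[of "n - 1"]
        by (auto simp: \<beta>_def bij_betw_def inj_def split: nat.splits)
    qed
    have "range \<beta> = insert (\<beta> 0) (range (\<lambda>m. \<beta> (Suc m)))"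
      by (auto simp: image_iff) (metis not0_implies_Suc)
    also have "\<dots> = wandering_index N"
      using bij by (auto simp: \<beta>_def wandering_index_def bij_betw_def)
    finally show "range \<beta> = wandering_index N" .
  qed
  moreover have "\<beta> 0 = ([], 0)" by (simp add: \<beta>_def)
  ultimately show ?thesis by (rule that)
qed

theorem theorem3p19:
  fixes N :: nat
  assumes "N \<ge> 1"
  shows "(N \<ge> 2 \<longrightarrow> unit_equiv N (tree_lap N) UNIV (T_model N)) \<and>
         (N = 1 \<longrightarrow> unit_equiv N (tree_lap N) {0} (T_model N))"
proof (intro conjI impI)
  assume "N \<ge> 2"
  then obtain \<beta> :: "nat \<Rightarrow> nat list \<times> nat"
    where "bij_betw \<beta> UNIV (wandering_index N)" "\<beta> 0 = ([], 0)"
    by (rule wandering_index_enum)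
  with assms show "unit_equiv N (tree_lap N) UNIV (T_model N)"
    by (intro unit_equiv_of_wandering_index_enum[where \<beta> = \<beta>]) auto
next
  assume "N = 1"
  \<comment> \<open>With one letter there is no nontrivial character, so the root chain is the whole
    space.\<close>
  then have "bij_betw (\<lambda>_. ([], 0)) {0} (wandering_index N)" by (auto simp: bij_betw_def wandering_index_def)
  then show "unit_equiv N (tree_lap N) {0} (T_model N)"
    using assms by (intro unit_equiv_of_wandering_index_enum[where \<beta> = "\<lambda>_. ([], 0)"]) auto
qed

end
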